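(* Let $\psi:\mathbb{N}\to\mathbb{R}^+$ be a non-increasing function with $\sum_{q=1}^{\infty}\psi(q)\log q=\infty$. Then for every non-Liouville real number $\gamma$ and every real number $\gamma'$, for Lebesgue almost all $(x,y)\in[0,1]^2$ there are infinitely many integers $q\in\mathbb{N}$ with $$\|qx-\gamma\|\,\|qy-\gamma'\|\le\psi(q).$$
   Context: $\mathbb{N}=\{1,2,3,\dots\}$ and $\mathbb{R}^+=(0,\infty)$. For real $x$, $\|x\|$ is the distance from $x$ to the nearest integer. $\log$ is the base $2$ logarithm. "Non-Liouville" means not a Liouville number in the standard sense. *)

theory Defs
  imports "HOL-Analysis.Analysis"
begin

definition dist_int :: "real \<Rightarrow> real" where
  "dist_int x = \<bar>x - of_int (round x)\<bar>"

text \<open>The strict lower bound makes every Liouville number irrational, so rational numbers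
  are non-Liouville.\<close>

definition liouville :: "real \<Rightarrow> bool" where
  "liouville x \<longleftrightarrow>
    (\<forall>n::nat. \<exists>p q::int. q > 1 \<and>
      0 < \<bar>x - of_int p / of_int q\<bar> \<and> \<bar>x - of_int p / of_int q\<bar> < 1 / of_int q ^ n)"

end

theory Submission
  imports Defs "HOL-Library.Log_Nat"
begin

text \<open>A second moment argument. For each \<open>q\<close> the hyperbolic region is replaced by the
  product sets \<open>\<parallel>q x - \<gamma>\<parallel> \<le> 4\<^sup>-\<^sup>k\<close>, \<open>\<parallel>q y - \<gamma>'\<parallel> \<le> 4\<^sup>k \<psi> q\<close> for about \<open>log q\<close> values of \<open>k\<close>,
  each of measure \<open>4 \<psi> q\<close>. The one-dimensional overlap of the sets at \<open>q\<close> and \<open>r\<close> exceeds the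
  product of the measures by at most \<open>2 gcd q r min (\<alpha> / q) (\<beta> / r)\<close>. Multiplying the bounds in
  \<open>x\<close> and \<open>y\<close> and summing over the scales (\<open>k\<close> stays away from both ends, which makes the mixed
  terms small), the excess for the pair \<open>(q, r)\<close> is of order \<open>(a b)\<^sup>-\<^sup>2\<^sup>/\<^sup>3\<close> times the geometric mean
  of \<open>\<psi> q log q\<close> and \<open>\<psi> r log r\<close>, where \<open>a = q / gcd q r\<close> and \<open>b = r / gcd q r\<close>. As \<open>\<psi>\<close> is
  monotone, the total weight of the multiples of \<open>a\<close> is \<open>O(1 / a)\<close> of the whole, so the variance
  of the counting function is bounded by a multiple of its mean, which tends to infinity.\<close>

section \<open>Periodic functions and the distance to the nearest integer\<close>

lemma dist_int_le_iff: "dist_int x \<le> \<beta> \<longleftrightarrow> (\<exists>m::int. \<bar>x - of_int m\<bar> \<le> \<beta>)"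
proof
  assume "\<exists>m::int. \<bar>x - of_int m\<bar> \<le> \<beta>"
  then obtain m :: int where "\<bar>x - of_int m\<bar> \<le> \<beta>" ..
  moreover have "dist_int x \<le> \<bar>x - of_int m\<bar>"
    unfolding dist_int_def by (rule round_diff_minimal)
  ultimately show "dist_int x \<le> \<beta>" by simp
qed (auto simp: dist_int_def)

lemma dist_int_add_of_int [simp]: "dist_int (x + of_int m) = dist_int x"
proof -
  have "round (x + of_int m) = round x + m"
    using floor_add_int[of "x + 1/2" m] by (simp add: round_def algebra_simps)
  then show ?thesis by (simp add: dist_int_def)
qed

lemma borel_measurable_dist_int [measurable]: "dist_int \<in> borel_measurable borel"
  unfolding dist_int_def [abs_def] round_def by measurable

text \<open>Only the fractional part \<open>s\<close> of \<open>c\<close> matters. The unit interval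
  is cut at \<open>1 - s\<close>, where \<open>x + s\<close> reaches 1, and the piece beyond the cut
  is moved back by one period.\<close>

lemma nn_integral_periodic_shift:
  fixes f :: "real \<Rightarrow> ennreal"
  assumes [measurable]: "f \<in> borel_measurable borel"
    and per: "\<And>x m. f (x + of_int m) = f x"
  shows "(\<integral>\<^sup>+x. f (x + c) * indicator {0..<1} x \<partial>lborel) = (\<integral>\<^sup>+x. f x * indicator {0..<1} x \<partial>lborel)"
proof -
  define s where "s = frac c"
  have s: "0 \<le> s" "s < 1" by (auto simp: s_def frac_lt_1)
  have c: "f (x + c) = f (x + s)" for x
    using per[of "x + s" "\<lfloor>c\<rfloor>"] by (simp add: s_def frac_def)
  have "(\<integral>\<^sup>+x. f (x + c) * indicator {0..<1} x \<partial>lborel)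
      = (\<integral>\<^sup>+x. f (x + s) * indicator {0..<1-s} x + f (x + s - 1) * indicator {1-s..<1} x \<partial>lborel)"
    using s c per[of "x + s - 1" 1 for x]
    by (intro nn_integral_cong) (auto simp: indicator_def)
  also have "\<dots> = (\<integral>\<^sup>+x. f (x + s) * indicator {0..<1-s} x \<partial>lborel)
      + (\<integral>\<^sup>+x. f (x + s - 1) * indicator {1-s..<1} x \<partial>lborel)"
    by (rule nn_integral_add) auto
  also have "(\<integral>\<^sup>+x. f (x + s) * indicator {0..<1-s} x \<partial>lborel) = (\<integral>\<^sup>+x. f x * indicator {s..<1} x \<partial>lborel)"
    by (subst (2) nn_integral_real_affine[of _ 1 s])
       (auto simp: indicator_def add.commute intro!: nn_integral_cong)
  also have "(\<integral>\<^sup>+x. f (x + s - 1) * indicator {1-s..<1} x \<partial>lborel) = (\<integral>\<^sup>+x. f x * indicator {0..<s} x \<partial>lborel)"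
    by (subst (2) nn_integral_real_affine[of _ 1 "s - 1"])
       (auto simp: indicator_def algebra_simps intro!: nn_integral_cong)
  also have "(\<integral>\<^sup>+x. f x * indicator {s..<1} x \<partial>lborel) + (\<integral>\<^sup>+x. f x * indicator {0..<s} x \<partial>lborel)
     = (\<integral>\<^sup>+x. f x * indicator {s..<1} x + f x * indicator {0..<s} x \<partial>lborel)"
    by (rule nn_integral_add [symmetric]) auto
  also have "\<dots> = (\<integral>\<^sup>+x. f x * indicator {0..<1} x \<partial>lborel)"
    using s by (intro nn_integral_cong) (auto simp: indicator_def)
  finally show ?thesis .
qed

text \<open>The integral of \<open>f\<close> over \<open>{0..<real q}\<close> is evaluated twice: by
  periodicity it is \<open>q\<close> copies of the right side, by rescaling it is \<open>q\<close>
  times the left side. The factor \<open>q\<close> then cancels.\<close>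

lemma nn_integral_periodic_scale:
  fixes f :: "real \<Rightarrow> ennreal" and q :: nat
  assumes [measurable]: "f \<in> borel_measurable borel"
    and per: "\<And>x m. f (x + of_int m) = f x" and q: "q > 0"
  shows "(\<integral>\<^sup>+x. f (q * x) * indicator {0..<1} x \<partial>lborel) = (\<integral>\<^sup>+x. f x * indicator {0..<1} x \<partial>lborel)"
    (is "?L = ?R")
proof -
  have "(\<Sum>j<q. (indicator {real j..<real j + 1} x :: ennreal)) = indicator {0..<real q} x" for x
    by (induction q) (auto simp: indicator_def)
  then have "(\<integral>\<^sup>+x. f x * indicator {0..<real q} x \<partial>lborel)
     = (\<integral>\<^sup>+x. (\<Sum>j<q. f x * indicator {real j..<real j + 1} x) \<partial>lborel)"
    by (simp flip: sum_distrib_left)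
  also have "\<dots> = (\<Sum>j<q. \<integral>\<^sup>+x. f x * indicator {real j..<real j + 1} x \<partial>lborel)"
    by (rule nn_integral_sum) auto
  also have "\<dots> = (\<Sum>j<q. ?R)"
  proof (rule sum.cong)
    fix j :: nat
    have "(\<integral>\<^sup>+x. f x * indicator {real j..<real j + 1} x \<partial>lborel)
        = (\<integral>\<^sup>+x. f x * indicator {0..<1} x \<partial>lborel)"
      using per[of _ "int j"]
      by (subst nn_integral_real_affine[of _ 1 "real j"])
         (auto simp: indicator_def add.commute intro!: nn_integral_cong)
    then show "(\<integral>\<^sup>+x. f x * indicator {real j..<real j + 1} x \<partial>lborel) = ?R" .
  qed simp
  also have "\<dots> = of_nat q * ?R" by simp
  finally have 1: "(\<integral>\<^sup>+x. f x * indicator {0..<real q} x \<partial>lborel) = of_nat q * ?R" .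
  have "(\<integral>\<^sup>+x. f x * indicator {0..<real q} x \<partial>lborel) = of_nat q * ?L"
    using q
    by (subst nn_integral_real_affine[of _ "real q" 0])
       (auto simp: indicator_def ennreal_of_nat_eq_real_of_nat zero_le_mult_iff
         intro!: nn_integral_cong arg_cong[where f = "\<lambda>z. _ * z"])
  with 1 q show ?thesis
    by (simp add: ennreal_mult_cancel_left)
qed

lemma nn_integral_dist_int_le:
  fixes q :: nat
  assumes q: "q > 0" and \<alpha>: "0 \<le> \<alpha>" "\<alpha> < 1/2"
  shows "(\<integral>\<^sup>+x. indicator {t. dist_int t \<le> \<alpha>} (q * x - \<gamma>) * indicator {0..<1} x \<partial>lborel) = ennreal (2 * \<alpha>)"
proof -
  let ?h = "indicator {t. dist_int t \<le> \<alpha>} :: real \<Rightarrow> ennreal"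
  have per: "?h (x + of_int m) = ?h x" for x m by (simp add: indicator_def)
  have "(\<integral>\<^sup>+x. ?h (q * x - \<gamma>) * indicator {0..<1} x \<partial>lborel) = (\<integral>\<^sup>+x. ?h (x - \<gamma>) * indicator {0..<1} x \<partial>lborel)"
    using per[of "x - \<gamma>" for x] q
    by (intro nn_integral_periodic_scale[of "\<lambda>x. ?h (x - \<gamma>)"]) (auto simp: algebra_simps)
  also have "\<dots> = (\<integral>\<^sup>+x. ?h x * indicator {0..<1} x \<partial>lborel)"
    using nn_integral_periodic_shift[of ?h "- \<gamma>"] per by simp
  \<comment> \<open>In the unit interval the points close to an integer sit at both ends. Moving the
    centre to 1/2 makes them one interval, which fits inside because
    \<open>\<alpha> < 1/2\<close>.\<close>
  also have "\<dots> = (\<integral>\<^sup>+x. ?h (x + 1/2) * indicator {0..<1} x \<partial>lborel)"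
    using nn_integral_periodic_shift[of ?h "1/2"] per by simp
  also have "\<dots> = (\<integral>\<^sup>+x. ?h (x - 1/2) * indicator {0..<1} x \<partial>lborel)"
    by (intro nn_integral_cong) (use per[of "_ - 1/2" 1] in \<open>simp add: add.commute\<close>)
  also have "\<dots> = (\<integral>\<^sup>+x. indicator {1/2 - \<alpha>..1/2 + \<alpha>} x \<partial>lborel)"
  proof (rule nn_integral_cong)
    fix x :: real
    have "dist_int (x - 1/2) \<le> \<alpha> \<longleftrightarrow> \<bar>x - 1/2\<bar> \<le> \<alpha>" if "0 \<le> x" "x < 1"
    proof
      assume "dist_int (x - 1/2) \<le> \<alpha>"
      then obtain m :: int where m: "\<bar>x - 1/2 - of_int m\<bar> \<le> \<alpha>" by (auto simp: dist_int_le_iff)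
      with \<alpha> that have "real_of_int m < 1" "real_of_int m > -1" by linarith+
      then have "m = 0" by linarith
      with m show "\<bar>x - 1/2\<bar> \<le> \<alpha>" by simp
    next
      assume "\<bar>x - 1/2\<bar> \<le> \<alpha>"
      then show "dist_int (x - 1/2) \<le> \<alpha>" unfolding dist_int_le_iff by (intro exI[of _ 0]) simp
    qed
    then show "?h (x - 1/2) * indicator {0..<1} x = indicator {1/2 - \<alpha>..1/2 + \<alpha>} x"
      using \<alpha> by (auto simp: indicator_def abs_le_iff)
  qed
  also have "\<dots> = ennreal (2 * \<alpha>)" using \<alpha> by simp
  finally show ?thesis .
qed

lemma card_int_interval_le:
  fixes S :: "int set"
  assumes "\<And>n. n \<in> S \<Longrightarrow> u \<le> real_of_int n \<and> real_of_int n \<le> v" and "u \<le> v"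
  shows "real (card S) \<le> v - u + 1"
proof -
  have "S \<subseteq> {\<lceil>u\<rceil>..\<lfloor>v\<rfloor>}" using assms by (auto simp: ceiling_le_iff le_floor_iff)
  then have "card S \<le> card {\<lceil>u\<rceil>..\<lfloor>v\<rfloor>}" by (intro card_mono) auto
  also have "\<dots> = nat (\<lfloor>v\<rfloor> - \<lceil>u\<rceil> + 1)" by simp
  finally have "real (card S) \<le> real (nat (\<lfloor>v\<rfloor> - \<lceil>u\<rceil> + 1))" by simp
  also have "\<dots> \<le> v - u + 1" using assms(2) by linarith
  finally show ?thesis .
qed

text \<open>With \<open>m j\<close> the nearest integer, \<open>f j = b * j - a * m j\<close> is
  congruent to \<open>b * j\<close> modulo \<open>a\<close>. As \<open>b\<close> is invertible
  modulo \<open>a\<close>, distinct \<open>j < a\<close> give distinct integers \<open>f j\<close>,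
  and all of them lie in an interval of length \<open>2 * a * \<beta>\<close>.\<close>

lemma card_dist_int_progression_le:
  fixes a b :: nat
  assumes cop: "coprime a b" and a: "a > 0" and \<beta>: "\<beta> \<ge> 0"
  shows "real (card {j. j < a \<and> dist_int (z + real b * real j / real a) \<le> \<beta>}) \<le> 2 * \<beta> * a + 1"
proof -
  let ?J = "{j. j < a \<and> dist_int (z + real b * real j / real a) \<le> \<beta>}"
  define m where "m j = round (z + real b * real j / real a)" for j
  have m: "\<bar>z + real b * real j / real a - of_int (m j)\<bar> \<le> \<beta>" if "j \<in> ?J" for j
    using that by (simp add: m_def dist_int_def)
  define f where "f j = int b * int j - int a * m j" for j
  have "inj_on f ?J"
  proof (rule inj_onI)
    fix i j assume ij: "i \<in> ?J" "j \<in> ?J" "f i = f j"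
    then have "int b * (int i - int j) = int a * (m i - m j)" by (simp add: f_def algebra_simps)
    then have "int a dvd int b * (int i - int j)" by (metis dvd_triv_left)
    with cop have "int a dvd int i - int j"
      by (simp add: coprime_dvd_mult_right_iff)
    moreover have "\<bar>int i - int j\<bar> < int a" using ij(1,2) by auto
    ultimately show "i = j" using dvd_imp_le_int[of "int i - int j" "int a"] by auto
  qed
  then have "card ?J = card (f ` ?J)" by (simp add: card_image)
  also have "real \<dots> \<le> (a * \<beta> - a * z) - (- (a * \<beta>) - a * z) + 1"
  proof (rule card_int_interval_le)
    fix n assume "n \<in> f ` ?J"
    then obtain j where j: "j \<in> ?J" "n = f j" by auto
    define c where "c = real b * real j / real a - of_int (m j)"
    have "real_of_int n = a * c"
      using a j(2) by (simp add: f_def c_def right_diff_distrib)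
    moreover have "- \<beta> - z \<le> c" "c \<le> \<beta> - z" using m[OF j(1)] by (auto simp: c_def)
    ultimately show "- (a * \<beta>) - a * z \<le> real_of_int n \<and> real_of_int n \<le> a * \<beta> - a * z"
      using a mult_left_mono[of "- \<beta> - z" c "real a"] mult_left_mono[of c "\<beta> - z" "real a"]
      by (auto simp: right_diff_distrib)
  qed (use \<beta> in auto)
  finally show ?thesis by (simp add: algebra_simps)
qed

section \<open>Overlaps in one dimension\<close>

text \<open>The half-open interval is exactly one period, matching the integration range of the
  shift and scaling lemmas.\<close>

definition near_set :: "nat \<Rightarrow> real \<Rightarrow> real \<Rightarrow> real set" where
  "near_set q \<gamma> \<alpha> = {x \<in> {0..<1}. dist_int (real q * x - \<gamma>) \<le> \<alpha>}"

lemma near_set_borel [measurable]: "near_set q \<gamma> \<alpha> \<in> sets borel"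
  unfolding near_set_def by measurable

lemma emeasure_near_set_Int:
  "emeasure lborel (near_set q \<gamma> \<alpha> \<inter> S) = (\<integral>\<^sup>+x. indicator {t. dist_int t \<le> \<alpha>} (q * x - \<gamma>) * indicator S x * indicator {0..<1} x \<partial>lborel)"
  if [measurable]: "S \<in> sets borel"
proof -
  have "emeasure lborel (near_set q \<gamma> \<alpha> \<inter> S) = (\<integral>\<^sup>+x. indicator (near_set q \<gamma> \<alpha> \<inter> S) x \<partial>lborel)"
    by (rule nn_integral_indicator [symmetric]) simp
  also have "\<dots> = (\<integral>\<^sup>+x. indicator {t. dist_int t \<le> \<alpha>} (q * x - \<gamma>) * indicator S x * indicator {0..<1} x \<partial>lborel)"
    by (rule nn_integral_cong) (auto simp: near_set_def indicator_def)
  finally show ?thesis .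
qed

lemma emeasure_near_set:
  assumes "q > 0" "0 \<le> \<alpha>" "\<alpha> < 1/2"
  shows "emeasure lborel (near_set q \<gamma> \<alpha>) = ennreal (2 * \<alpha>)"
  using emeasure_near_set_Int[of UNIV q \<gamma> \<alpha>] nn_integral_dist_int_le[of q \<alpha> \<gamma>] assms by simp

text \<open>Translating by \<open>j / q\<close> fixes the condition at \<open>q\<close>; averaging over \<open>j\<close> equidistributes
  the condition at \<open>r\<close>.\<close>

lemma emeasure_near_set_Int_le:
  fixes q r :: nat
  assumes q: "q > 0" and r: "r > 0" and \<alpha>: "0 \<le> \<alpha>" "\<alpha> < 1/2" and \<beta>: "0 \<le> \<beta>"
  shows "emeasure lborel (near_set q \<gamma> \<alpha> \<inter> near_set r \<gamma> \<beta>)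
    \<le> ennreal (4 * \<alpha> * \<beta> + 2 * real (gcd q r) * (\<alpha> / q))"
proof -
  define g where "g = gcd q r"
  define a b where "a = q div g" and "b = r div g"
  have g: "g > 0" and qa: "q = g * a" and rb: "r = g * b" and cop: "coprime a b"
    using q by (auto simp: g_def a_def b_def intro!: div_gcd_coprime)
  have a: "a > 0" using q qa by simp
  let ?h = "\<lambda>\<beta>. indicator {t. dist_int t \<le> \<beta>} :: real \<Rightarrow> ennreal"
  let ?F = "\<lambda>x::real. ?h \<alpha> (q * x - \<gamma>) * ?h \<beta> (r * x - \<gamma>)"
  let ?X = "\<integral>\<^sup>+x. ?F x * indicator {0..<1} x \<partial>lborel"
  have X: "emeasure lborel (near_set q \<gamma> \<alpha> \<inter> near_set r \<gamma> \<beta>) = ?X"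
    by (subst emeasure_near_set_Int) (auto intro!: nn_integral_cong simp: near_set_def indicator_def)
  have per: "?F (x + of_int m) = ?F x" for x m
    using dist_int_add_of_int[of "q * x - \<gamma>" "int q * m"] dist_int_add_of_int[of "r * x - \<gamma>" "int r * m"]
    by (simp add: indicator_def algebra_simps)
  have shift: "?X = (\<integral>\<^sup>+x. ?h \<alpha> (q * x - \<gamma>) * ?h \<beta> ((r * x - \<gamma>) + real b * real j / real a) * indicator {0..<1} x \<partial>lborel)" for j :: nat
  proof -
    have eq: "?F (x + real j / real q) = ?h \<alpha> (q * x - \<gamma>) * ?h \<beta> ((r * x - \<gamma>) + real b * real j / real a)" for x :: real
    proof -
      have "real q * (x + real j / real q) - \<gamma> = (real q * x - \<gamma>) + of_int (int j)"
        using q by (simp add: field_simps)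
      moreover have "real r * (x + real j / real q) - \<gamma> = (r * x - \<gamma>) + real b * real j / real a"
        using g a by (simp add: qa rb field_simps)
      ultimately show ?thesis by (simp only: indicator_def mem_Collect_eq dist_int_add_of_int)
    qed
    have "?X = (\<integral>\<^sup>+x. ?F (x + real j / real q) * indicator {0..<1} x \<partial>lborel)"
      by (rule nn_integral_periodic_shift [symmetric]) (use per in auto)
    then show ?thesis by (simp only: eq)
  qed
  have "of_nat a * ?X = (\<Sum>j<a. ?X)" by simp
  also have "\<dots> = (\<Sum>j<a. \<integral>\<^sup>+x. ?h \<alpha> (q * x - \<gamma>) * ?h \<beta> ((r * x - \<gamma>) + real b * real j / real a) * indicator {0..<1} x \<partial>lborel)"
    by (intro sum.cong refl shift)
  also have "\<dots> = (\<integral>\<^sup>+x. (\<Sum>j<a. ?h \<alpha> (q * x - \<gamma>) * ?h \<beta> ((r * x - \<gamma>) + real b * real j / real a) * indicator {0..<1} x) \<partial>lborel)"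
    by (rule nn_integral_sum [symmetric]) auto
  \<comment> \<open>The condition at \<open>q\<close> does not depend on \<open>j\<close> and is
    pulled out of the sum; for each \<open>x\<close> at most \<open>2 * \<beta> * a + 1\<close> of
    the \<open>a\<close> translates satisfy the condition at \<open>r\<close>.\<close>
  also have "\<dots> \<le> (\<integral>\<^sup>+x. ennreal (2 * \<beta> * a + 1) * (?h \<alpha> (q * x - \<gamma>) * indicator {0..<1} x) \<partial>lborel)"
  proof (rule nn_integral_mono)
    fix x :: real
    have "(\<Sum>j<a. ?h \<beta> ((r * x - \<gamma>) + real b * real j / real a))
        = of_nat (card {j. j < a \<and> dist_int ((r * x - \<gamma>) + real b * real j / real a) \<le> \<beta>})"
      by (simp add: indicator_def sum.If_cases lessThan_def Int_def conj_commute)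
    also have "\<dots> \<le> ennreal (2 * \<beta> * a + 1)"
      using card_dist_int_progression_le[OF cop a \<beta>(1), of "r * x - \<gamma>"]
      by (simp add: ennreal_of_nat_eq_real_of_nat ennreal_leI)
    finally have le: "(\<Sum>j<a. ?h \<beta> ((r * x - \<gamma>) + real b * real j / real a)) \<le> ennreal (2 * \<beta> * a + 1)" .
    have "(\<Sum>j<a. ?h \<alpha> (q * x - \<gamma>) * ?h \<beta> ((r * x - \<gamma>) + real b * real j / real a) * indicator {0..<1} x)
       = (\<Sum>j<a. ?h \<beta> ((r * x - \<gamma>) + real b * real j / real a)) * (?h \<alpha> (q * x - \<gamma>) * indicator {0..<1} x)"
      unfolding sum_distrib_right by (intro sum.cong) (auto simp: mult_ac)
    with le show "(\<Sum>j<a. ?h \<alpha> (q * x - \<gamma>) * ?h \<beta> ((r * x - \<gamma>) + real b * real j / real a) * indicator {0..<1} x)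
       \<le> ennreal (2 * \<beta> * a + 1) * (?h \<alpha> (q * x - \<gamma>) * indicator {0..<1} x)"
      by (metis mult_right_mono zero_le)
  qed
  also have "\<dots> = ennreal (2 * \<beta> * a + 1) * ennreal (2 * \<alpha>)"
    by (subst nn_integral_cmult) (auto simp: nn_integral_dist_int_le[OF q \<alpha>])
  also have "\<dots> = ennreal ((2 * \<beta> * a + 1) * (2 * \<alpha>))"
    using \<alpha> \<beta> by (intro ennreal_mult [symmetric]) auto
  \<comment> \<open>The extra 1 in the count is the source of the gcd term: divided by
    \<open>a\<close> it leaves \<open>2 * \<alpha> / a\<close>, and
    \<open>1 / a = g / q\<close>.\<close>
  also have "(2 * \<beta> * a + 1) * (2 * \<alpha>) = real a * (4 * \<alpha> * \<beta> + 2 * real g * (\<alpha> / q))"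
    using a g by (simp add: qa field_simps)
  also have "ennreal \<dots> = of_nat a * ennreal (4 * \<alpha> * \<beta> + 2 * real g * (\<alpha> / q))"
    using \<alpha> \<beta> by (subst ennreal_mult) (auto simp: ennreal_of_nat_eq_real_of_nat)
  finally show ?thesis
    using a unfolding X g_def [symmetric]
    by (simp add: ennreal_mult_le_mult_iff ennreal_of_nat_eq_real_of_nat)
qed

lemma measure_near_set:
  assumes "q > 0" "0 \<le> \<alpha>" "\<alpha> < 1/2"
  shows "measure lborel (near_set q \<gamma> \<alpha>) = 2 * \<alpha>"
  using emeasure_near_set[OF assms, of \<gamma>] assms by (simp add: measure_def)

text \<open>The error term of \<open>emeasure_near_set_Int_le\<close> singles out \<open>q\<close>;
  using that bound also with the two sets exchanged yields the minimum.\<close>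

lemma measure_near_set_Int_le:
  fixes q r :: nat
  assumes q: "q > 0" and r: "r > 0" and \<alpha>: "0 \<le> \<alpha>" "\<alpha> < 1/2" and \<beta>: "0 \<le> \<beta>" "\<beta> < 1/2"
  shows "measure lborel (near_set q \<gamma> \<alpha> \<inter> near_set r \<gamma> \<beta>)
    \<le> 4 * \<alpha> * \<beta> + 2 * real (gcd q r) * min (\<alpha> / q) (\<beta> / r)"
proof -
  have 1: "measure lborel (near_set q \<gamma> \<alpha> \<inter> near_set r \<gamma> \<beta>) \<le> 4 * \<alpha> * \<beta> + 2 * real (gcd q r) * (\<alpha> / q)"
    if "q > 0" "r > 0" "0 \<le> \<alpha>" "\<alpha> < 1/2" "0 \<le> \<beta>" for q r \<alpha> \<beta>
    unfolding measure_def using that by (intro enn2real_leI emeasure_near_set_Int_le) auto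
  from 1[OF q r \<alpha> \<beta>(1)] 1[OF r q \<beta> \<alpha>(1)] show ?thesis
    by (simp add: min_def Int_commute gcd.commute mult_ac)
qed

section \<open>A second moment lemma\<close>

text \<open>Chebyshev's inequality for the counting functions \<open>Z N\<close> with mean
  \<open>S N\<close>. A point in finitely many sets has bounded counts, so it lies in some
  \<open>B K\<close>; since the variance is at most \<open>C * S N\<close> and \<open>S N\<close>
  tends to infinity, each \<open>B K\<close> is null.\<close>

lemma AE_infinite_of_variance_bound:
  fixes E :: "'i \<Rightarrow> 'a set" and F :: "nat \<Rightarrow> 'i set"
  assumes fin_M: "finite_measure M" and M1: "measure M (space M) = 1"
    and fin: "\<And>N. finite (F N)"
    and E [measurable]: "\<And>i. E i \<in> sets M"
    and div: "filterlim (\<lambda>N. \<Sum>i\<in>F N. measure M (E i)) at_top sequentially"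
    and var: "\<And>N. (\<Sum>i\<in>F N. \<Sum>j\<in>F N. measure M (E i \<inter> E j))
      \<le> (\<Sum>i\<in>F N. measure M (E i))\<^sup>2 + C * (\<Sum>i\<in>F N. measure M (E i))"
  shows "AE x in M. infinite {i \<in> (\<Union>N. F N). x \<in> E i}"
proof -
  define S where "S N = (\<Sum>i\<in>F N. measure M (E i))" for N
  define Z where "Z N x = (\<Sum>i\<in>F N. indicator (E i) x :: real)" for N x
  have [measurable]: "Z N \<in> borel_measurable M" for N
    unfolding Z_def [abs_def] by measurable
  have [simp]: "emeasure M A < top" for A by (simp add: finite_measure.emeasure_eq_measure [OF fin_M])
  have S: "filterlim S at_top sequentially" using div by (simp add: S_def [abs_def])
  define Q where "Q N x = (\<Sum>i\<in>F N. \<Sum>j\<in>F N. indicator (E i \<inter> E j) x :: real)" for N x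
  have intZ: "integrable M (Z N)" for N
    unfolding Z_def [abs_def] by (intro Bochner_Integration.integrable_sum integrable_real_indicator) auto
  have intQ: "integrable M (Q N)" for N
    unfolding Q_def [abs_def] by (intro Bochner_Integration.integrable_sum integrable_real_indicator) auto
  have LZ: "(\<integral>x. Z N x \<partial>M) = S N" for N
    unfolding Z_def S_def by (subst Bochner_Integration.integral_sum) auto
  have LQ: "(\<integral>x. Q N x \<partial>M) = (\<Sum>i\<in>F N. \<Sum>j\<in>F N. measure M (E i \<inter> E j))" for N
    unfolding Q_def by (subst Bochner_Integration.integral_sum, simp)+ simp
  have sq: "(Z N x - S N)\<^sup>2 = Q N x - 2 * S N * Z N x + (S N)\<^sup>2" for N x
  proof -
    have "(Z N x)\<^sup>2 = Q N x"
      by (simp add: Z_def Q_def power2_eq_square sum_product indicator_inter_arith)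
    then show ?thesis by (simp add: power2_diff algebra_simps)
  qed
  have int: "integrable M (\<lambda>x. (Z N x - S N)\<^sup>2)" for N
    unfolding sq
    by (intro Bochner_Integration.integrable_add Bochner_Integration.integrable_diff
        integrable_mult_right intZ intQ finite_measure.integrable_const [OF fin_M])
  have "(\<integral>x. (Z N x - S N)\<^sup>2 \<partial>M) = (\<Sum>i\<in>F N. \<Sum>j\<in>F N. measure M (E i \<inter> E j)) - 2 * S N * S N + (S N)\<^sup>2" for N
    unfolding sq using intZ[of N] intQ[of N] finite_measure.integrable_const[OF fin_M, of "(S N)\<^sup>2"]
    by (simp add: LZ LQ M1)
  then have var': "(\<integral>x. (Z N x - S N)\<^sup>2 \<partial>M) \<le> C * S N" for N
    using var[of N] by (simp add: S_def power2_eq_square)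
  define B where "B K = {x \<in> space M. \<forall>N. Z N x \<le> real K}" for K :: nat
  have [measurable]: "B K \<in> sets M" for K unfolding B_def by measurable
  have "measure M (B K) \<le> 0" for K
  proof (rule tendsto_lowerbound)
    show "((\<lambda>N. 4 * C / S N) \<longlongrightarrow> 0) sequentially"
      by (rule real_tendsto_divide_at_top[OF tendsto_const S])
    have "\<forall>\<^sub>F N in sequentially. S N > 2 * real K"
      using S by (simp add: filterlim_at_top_dense)
    then show "\<forall>\<^sub>F N in sequentially. measure M (B K) \<le> 4 * C / S N"
    proof eventually_elim
      case (elim N)
      then have pos: "S N > 0" by (rule le_less_trans[rotated]) simp
      \<comment> \<open>Once the mean exceeds \<open>2 * K\<close>, a count of at most
        \<open>K\<close> deviates from the mean by at least half of it.\<close>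
      have "B K \<subseteq> {x \<in> space M. (Z N x - S N)\<^sup>2 \<ge> (S N / 2)\<^sup>2}"
      proof
        fix x assume "x \<in> B K"
        then have "x \<in> space M" "Z N x \<le> real K" by (auto simp: B_def)
        with elim have "S N / 2 \<le> \<bar>Z N x - S N\<bar>" by simp
        with pos \<open>x \<in> space M\<close> show "x \<in> {x \<in> space M. (Z N x - S N)\<^sup>2 \<ge> (S N / 2)\<^sup>2}"
          by (simp add: abs_le_square_iff [symmetric])
      qed
      then have "measure M (B K) \<le> measure M {x \<in> space M. (Z N x - S N)\<^sup>2 \<ge> (S N / 2)\<^sup>2}"
        by (intro finite_measure.finite_measure_mono [OF fin_M]) measurable
      also have "\<dots> \<le> (\<integral>x. (Z N x - S N)\<^sup>2 \<partial>M) / (S N / 2)\<^sup>2"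
        by (rule integral_Markov_inequality_measure[where A = "{}"]) (use int pos in auto)
      also have "\<dots> \<le> C * S N / (S N / 2)\<^sup>2"
        using var'[of N] by (intro divide_right_mono) auto
      also have "\<dots> = 4 * C / S N" using pos by (simp add: power2_eq_square field_simps)
      finally show ?case .
    qed
  qed simp
  then have "B K \<in> null_sets M" for K
    by (intro null_setsI) (auto simp: finite_measure.emeasure_eq_measure [OF fin_M] measure_le_0_iff)
  then have "AE x in M. x \<notin> B K" for K by (rule AE_not_in)
  then have "AE x in M. \<forall>K. x \<notin> B K" by (subst AE_all_countable) auto
  then show ?thesis
  proof (rule AE_mp[OF _ AE_I2], intro impI notI)
    fix x assume x: "x \<in> space M" "\<forall>K. x \<notin> B K" and f: "finite {i \<in> (\<Union>N. F N). x \<in> E i}"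
    have "Z N x \<le> real (card {i \<in> (\<Union>N. F N). x \<in> E i})" for N
    proof -
      have "Z N x = real (card {i \<in> F N. x \<in> E i})"
        using fin by (simp add: Z_def indicator_def sum.If_cases Int_def)
      also have "\<dots> \<le> real (card {i \<in> (\<Union>N. F N). x \<in> E i})"
        using f by (intro of_nat_mono card_mono) auto
      finally show ?thesis .
    qed
    with x show False by (auto simp: B_def)
  qed
qed

section \<open>Sums over greatest common divisors\<close>

text \<open>For \<open>c \<ge> 1\<close> the second argument is always the smaller one, so this is a
  geometric series; removing its first term replaces \<open>c\<close> by
  \<open>2 * c\<close>.\<close>

lemma sum_min_geometric_le_aux:
  fixes c :: real
  assumes "c \<ge> 1"
  shows "(\<Sum>l<n. min (2 ^ l * c) (1 / (2 ^ l * c))) \<le> 2 / c"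
  using assms
proof (induction n arbitrary: c)
  case (Suc n)
  have "(\<Sum>l<Suc n. min (2 ^ l * c) (1 / (2 ^ l * c)))
      = min c (1 / c) + (\<Sum>l<n. min (2 ^ l * (2 * c)) (1 / (2 ^ l * (2 * c))))"
    by (simp add: sum.lessThan_Suc_shift mult_ac del: sum.lessThan_Suc)
  also have "\<dots> \<le> 1 / c + 2 / (2 * c)"
    using Suc.IH[of "2 * c"] Suc.prems by (intro add_mono) auto
  finally show ?case by simp
qed simp

lemma sum_min_geometric_le:
  fixes c :: real
  assumes "c > 0"
  shows "(\<Sum>l<n. min (2 ^ l * c) (1 / (2 ^ l * c))) \<le> 4"
proof -
  \<comment> \<open>The bound is sharpened to \<open>4 - c\<close> for the induction: the first term
    \<open>c\<close> plus \<open>4 - 2 * c\<close> for the rest is again \<open>4 - c\<close>. Once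
    \<open>2 * c\<close> passes 1, the terms decay and the previous lemma takes over.\<close>
  have "(\<Sum>l<n. min (2 ^ l * c) (1 / (2 ^ l * c))) \<le> 4 - c" if "0 < c" "c < 1" for c :: real
    using that
  proof (induction n arbitrary: c)
    case (Suc n)
    have "(\<Sum>l<Suc n. min (2 ^ l * c) (1 / (2 ^ l * c)))
        = min c (1 / c) + (\<Sum>l<n. min (2 ^ l * (2 * c)) (1 / (2 ^ l * (2 * c))))"
      by (simp add: sum.lessThan_Suc_shift mult_ac del: sum.lessThan_Suc)
    also have "\<dots> \<le> 4 - c"
    proof (cases "2 * c < 1")
      case True
      then have "(\<Sum>l<n. min (2 ^ l * (2 * c)) (1 / (2 ^ l * (2 * c)))) \<le> 4 - 2 * c"
        using Suc.IH[of "2 * c"] Suc.prems by simp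
      then show ?thesis by simp
    next
      case False
      then have "(\<Sum>l<n. min (2 ^ l * (2 * c)) (1 / (2 ^ l * (2 * c)))) \<le> 2 / (2 * c)"
        by (intro sum_min_geometric_le_aux) auto
      moreover have "1 / c \<le> 2" using False Suc.prems by (simp add: field_simps)
      ultimately show ?thesis using Suc.prems by simp
    qed
    finally show ?case .
  qed simp
  moreover have "(\<Sum>l<n. min (2 ^ l * c) (1 / (2 ^ l * c))) \<le> 4" if "c \<ge> 1"
  proof -
    have "2 / c \<le> 4" using that by (simp add: field_simps)
    then show ?thesis using sum_min_geometric_le_aux[OF that, of n] by linarith
  qed
  ultimately show ?thesis using assms by (cases "c < 1") force+
qed

lemma min_le_sqrt_mult: "min x y \<le> sqrt (x * y)" if "x \<ge> 0" "y \<ge> 0" for x y :: real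
proof -
  have "(min x y)\<^sup>2 \<le> x * y"
    unfolding power2_eq_square using that by (intro mult_mono) auto
  then show ?thesis using real_le_rsqrt by blast
qed

text \<open>This refines \<open>min_le_sqrt_mult\<close>: the second factor records how far
  \<open>x / y\<close> is from 1, which later makes sums over scales converge geometrically.\<close>

lemma min_eq_sqrt_mult:
  fixes x y :: real
  assumes "x > 0" "y > 0"
  shows "min x y = sqrt (x * y) * min (sqrt (x / y)) (1 / sqrt (x / y))"
proof -
  have "x = sqrt x * sqrt x" "y = sqrt y * sqrt y" using assms by auto
  then have "sqrt (x * y) * sqrt (x / y) = x" "sqrt (x * y) * (1 / sqrt (x / y)) = y"
    using assms by (simp_all add: real_sqrt_mult real_sqrt_divide field_simps)
  moreover have "sqrt (x * y) \<ge> 0" using assms by simp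
  ultimately show ?thesis by (metis min_mult_distrib_left)
qed

text \<open>In terms of the reduced pair \<open>a\<close>, \<open>b\<close> the left side is
  \<open>(a * b) powr (-2/3) * sqrt (u * v)\<close>, the geometric mean of the two terms on the
  right, since -1/6 - 7/6 = -4/3. The split is uneven so that the exponent -7/6 is summable, while
  -1/6 becomes -7/6 after a further division by \<open>a\<close>.\<close>

lemma gcd_weight_le:
  fixes u v :: real
  assumes "q > 0" "r > 0" and uv: "u \<ge> 0" "v \<ge> 0"
  shows "((real (gcd q r))\<^sup>2 / (real q * real r)) powr (2/3) * sqrt (u * v)
    \<le> (real (q div gcd q r) powr (-1/6) * real (r div gcd q r) powr (-7/6) * u
      + real (r div gcd q r) powr (-1/6) * real (q div gcd q r) powr (-7/6) * v) / 2"
proof -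
  define g where "g = gcd q r"
  define a b where "a = q div g" and "b = r div g"
  have g: "g > 0" and q: "q = g * a" and r: "r = g * b"
    using assms(1,2) by (auto simp: g_def a_def b_def)
  have x: "(real g)\<^sup>2 / (real q * real r) = inverse (real a * real b)"
    using g by (simp add: q r power2_eq_square field_simps)
  define y z where "y = real a powr (-1/6) * real b powr (-7/6) * u"
    and "z = real b powr (-1/6) * real a powr (-7/6) * v"
  have "y * z = (real a powr (-1/6) * real a powr (-7/6)) * (real b powr (-1/6) * real b powr (-7/6)) * (u * v)"
    by (simp add: y_def z_def mult_ac)
  also have "\<dots> = (real a powr (-4/3) * real b powr (-4/3)) * (u * v)"
    by (simp flip: powr_add)
  also have "real a powr (-4/3) * real b powr (-4/3) = (inverse (real a * real b) powr (2/3))\<^sup>2"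
  proof -
    have "(inverse (real a * real b) powr (2/3))\<^sup>2 = inverse (real a * real b) powr (4/3)"
      by (simp add: power2_eq_square flip: powr_add)
    also have "\<dots> = (real a * real b) powr (-4/3)"
      by (simp add: powr_minus inverse_powr del: inverse_mult_distrib)
    finally show ?thesis by (simp add: powr_mult)
  qed
  finally have "sqrt (y * z) = inverse (real a * real b) powr (2/3) * sqrt (u * v)"
    by (simp add: real_sqrt_mult)
  moreover have "y \<ge> 0" "z \<ge> 0" using uv by (auto simp: y_def z_def)
  then have "sqrt (y * z) \<le> (y + z) / 2" by (rule arith_geo_mean_sqrt)
  ultimately show ?thesis
    using x by (simp add: y_def z_def a_def b_def g_def)
qed

text \<open>For fixed \<open>q\<close> the first component determines the gcd, and then the second
  determines \<open>r\<close>.\<close>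

lemma inj_on_div_gcd:
  fixes q :: nat
  assumes "q > 0"
  shows "inj_on (\<lambda>r. (q div gcd q r, r div gcd q r)) A"
proof (rule inj_onI)
  fix r s assume "(q div gcd q r, r div gcd q r) = (q div gcd q s, s div gcd q s)"
  then have e: "q div gcd q r = q div gcd q s" "r div gcd q r = s div gcd q s" by auto
  have q: "gcd q r * (q div gcd q r) = q" "gcd q s * (q div gcd q s) = q" by simp_all
  then have "gcd q r * (q div gcd q r) = gcd q s * (q div gcd q r)" by (simp only: e(1))
  moreover have "q div gcd q r \<noteq> 0" using q(1) assms by (intro notI) simp
  ultimately have "gcd q r = gcd q s"
    by (metis mult_cancel2)
  moreover have "r = gcd q r * (r div gcd q r)" "s = gcd q s * (s div gcd q s)" by simp_all
  ultimately show "r = s" using e(2) by simp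
qed

lemma div_gcd_in_range:
  fixes q r :: nat
  assumes "r \<in> {1..N}"
  shows "q div gcd q r dvd q" and "r div gcd q r \<in> {1..N}"
proof -
  have "gcd q r * (q div gcd q r) = q" by simp
  then show "q div gcd q r dvd q" by (metis dvd_triv_right)
  have "gcd q r * (r div gcd q r) = r" by simp
  then have "r div gcd q r \<noteq> 0" using assms by (metis atLeastAtMost_iff mult_0_right not_one_le_zero)
  moreover have "r div gcd q r \<le> N" by (rule order_trans[OF div_le_dividend]) (use assms in auto)
  ultimately show "r div gcd q r \<in> {1..N}" using assms by simp
qed

text \<open>By injectivity the sum over \<open>r\<close> runs over distinct pairs
  \<open>(a, b)\<close> with \<open>a dvd q\<close> and \<open>b \<le> N\<close>. Enlarging to all
  such pairs makes the sum factor.\<close>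

lemma sum_div_gcd_powr_le:
  assumes q: "q > 0"
  shows "(\<Sum>r=1..N. real (q div gcd q r) powr (-1/6) * real (r div gcd q r) powr (-7/6))
    \<le> (\<Sum>a | a dvd q. real a powr (-1/6)) * (\<Sum>b=1..N. real b powr (-7/6))"
proof -
  let ?f = "\<lambda>r. (q div gcd q r, r div gcd q r)"
  let ?h = "\<lambda>(a, b). real a powr (-1/6) * real b powr (-7/6)"
  have "(\<Sum>r=1..N. real (q div gcd q r) powr (-1/6) * real (r div gcd q r) powr (-7/6))
      = (\<Sum>r=1..N. ?h (?f r))"
    by simp
  also have "\<dots> = sum ?h (?f ` {1..N})"
    using sum.reindex[OF inj_on_div_gcd[OF q], of ?h "{1..N}"] by (simp only: o_def)
  also have "\<dots> \<le> sum ?h ({a. a dvd q} \<times> {1..N})"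
  proof (rule sum_mono2)
    show "finite ({a. a dvd q} \<times> {1..N})" using q by (intro finite_cartesian_product finite_divisors_nat) auto
    show "?f ` {1..N} \<subseteq> {a. a dvd q} \<times> {1..N}" using div_gcd_in_range[of _ N q] by blast
  qed auto
  also have "\<dots> = (\<Sum>a | a dvd q. \<Sum>b=1..N. real a powr (-1/6) * real b powr (-7/6))"
    by (rule sum.cartesian_product [symmetric])
  also have "\<dots> = (\<Sum>a | a dvd q. real a powr (-1/6)) * (\<Sum>b=1..N. real b powr (-7/6))"
    by (rule sum_product [symmetric])
  finally show ?thesis .
qed

text \<open>Exchanging the sums leaves, for each \<open>a\<close>, the weight of its multiples; the
  factor \<open>1 / a\<close> from \<open>mult\<close> lowers the exponent to -7/6.\<close>

lemma sum_divisors_powr_le: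
  fixes w :: "nat \<Rightarrow> real"
  assumes mult: "\<And>a. a \<in> {1..N} \<Longrightarrow> (\<Sum>q | q \<in> {1..N} \<and> a dvd q. w q) \<le> c / real a * W"
  shows "(\<Sum>q=1..N. \<Sum>a | a dvd q. real a powr (-1/6) * w q)
    \<le> (\<Sum>a=1..N. real a powr (-7/6)) * (c * W)"
proof -
  have "(\<Sum>q=1..N. \<Sum>a | a dvd q. real a powr (-1/6) * w q)
      = (\<Sum>q=1..N. \<Sum>a | a \<in> {1..N} \<and> a dvd q. real a powr (-1/6) * w q)"
  proof (rule sum.cong)
    fix q assume "q \<in> {1..N}"
    then have "{a. a dvd q} = {a. a \<in> {1..N} \<and> a dvd q}"
      by (auto dest: dvd_imp_le intro: Nat.gr0I Suc_leI)
    then show "(\<Sum>a | a dvd q. real a powr (-1/6) * w q)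
        = (\<Sum>a | a \<in> {1..N} \<and> a dvd q. real a powr (-1/6) * w q)" by simp
  qed simp
  also have "\<dots> = (\<Sum>a=1..N. \<Sum>q | q \<in> {1..N} \<and> a dvd q. real a powr (-1/6) * w q)"
    by (rule sum.swap_restrict) auto
  also have "\<dots> = (\<Sum>a=1..N. real a powr (-1/6) * (\<Sum>q | q \<in> {1..N} \<and> a dvd q. w q))"
    by (simp add: sum_distrib_left)
  also have "\<dots> \<le> (\<Sum>a=1..N. real a powr (-1/6) * (c / real a * W))"
    by (intro sum_mono mult_left_mono mult) auto
  also have "\<dots> = (\<Sum>a=1..N. real a powr (-7/6)) * (c * W)"
  proof -
    have "real a powr (-7/6) = real a powr (-1/6) / real a" if "a \<in> {1..N}" for a
      using that powr_diff[of "real a" "-1/6" 1] by simp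
    then show ?thesis unfolding sum_distrib_right by (intro sum.cong) auto
  qed
  finally show ?thesis .
qed

lemma sum_gcd_weights_le:
  fixes w :: "nat \<Rightarrow> real"
  assumes w: "\<And>q. w q \<ge> 0"
    and mult: "\<And>a. a \<in> {1..N} \<Longrightarrow> (\<Sum>q | q \<in> {1..N} \<and> a dvd q. w q) \<le> c / real a * (\<Sum>q=1..N. w q)"
    and c: "c \<ge> 0"
  shows "(\<Sum>q=1..N. \<Sum>r=1..N. ((real (gcd q r))\<^sup>2 / (real q * real r)) powr (2/3) * sqrt (w q * w r))
    \<le> c * (\<Sum>n. real n powr (-7/6))\<^sup>2 * (\<Sum>q=1..N. w q)"
proof -
  define Z where "Z = (\<Sum>n. real n powr (-7/6))"
  define ZN where "ZN = (\<Sum>n=1..N. real n powr (-7/6))"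
  define W where "W = (\<Sum>q=1..N. w q)"
  have Z: "ZN \<le> Z"
    unfolding Z_def ZN_def by (rule sum_le_suminf) (auto simp: summable_real_powr_iff)
  have Z0: "ZN \<ge> 0" by (simp add: ZN_def sum_nonneg)
  have W0: "W \<ge> 0" by (simp add: W_def sum_nonneg w)
  define H where "H q r = real (q div gcd q r) powr (-1/6) * real (r div gcd q r) powr (-7/6) * w q" for q r
  have "(\<Sum>q=1..N. \<Sum>r=1..N. ((real (gcd q r))\<^sup>2 / (real q * real r)) powr (2/3) * sqrt (w q * w r))
      \<le> (\<Sum>q=1..N. \<Sum>r=1..N. (H q r + H r q) / 2)"
  proof (intro sum_mono)
    fix q r assume "q \<in> {1..N}" "r \<in> {1..N}"
    then show "((real (gcd q r))\<^sup>2 / (real q * real r)) powr (2/3) * sqrt (w q * w r) \<le> (H q r + H r q) / 2"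
      using gcd_weight_le[of q r "w q" "w r"] w by (simp add: H_def gcd.commute[of r q])
  qed
  also have "\<dots> = ((\<Sum>q=1..N. \<Sum>r=1..N. H q r) + (\<Sum>q=1..N. \<Sum>r=1..N. H r q)) / 2"
    by (simp add: sum.distrib sum_divide_distrib add_divide_distrib)
  \<comment> \<open>The two halves from the arithmetic-geometric mean agree by symmetry, so only the
    one weighted by \<open>w q\<close> has to be bounded.\<close>
  also have "(\<Sum>q=1..N. \<Sum>r=1..N. H r q) = (\<Sum>q=1..N. \<Sum>r=1..N. H q r)"
    by (rule sum.swap)
  also have "((\<Sum>q=1..N. \<Sum>r=1..N. H q r) + (\<Sum>q=1..N. \<Sum>r=1..N. H q r)) / 2 = (\<Sum>q=1..N. \<Sum>r=1..N. H q r)"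
    by simp
  also have "\<dots> \<le> (\<Sum>q=1..N. (\<Sum>a | a dvd q. real a powr (-1/6)) * ZN * w q)"
    unfolding H_def ZN_def sum_distrib_right [symmetric]
    by (intro sum_mono mult_right_mono sum_div_gcd_powr_le w) auto
  also have "\<dots> = ZN * (\<Sum>q=1..N. \<Sum>a | a dvd q. real a powr (-1/6) * w q)"
    by (simp add: sum_distrib_left sum_distrib_right mult_ac)
  also have "\<dots> \<le> ZN * (ZN * (c * W))"
    using sum_divisors_powr_le[OF mult] Z0 by (intro mult_left_mono) (auto simp: ZN_def W_def)
  also have "\<dots> \<le> Z * (Z * (c * W))"
    using Z Z0 W0 c by (intro mult_mono) auto
  finally show ?thesis
    by (simp add: Z_def W_def power2_eq_square mult_ac)
qed

section \<open>Logarithmic weights\<close>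

text \<open>The base 64 makes both \<open>4\<^sup>-\<^sup>k\<close> and \<open>4\<^sup>k / q\<close> at most of order \<open>q\<^sup>-\<^sup>1\<^sup>/\<^sup>3\<close> for all
  \<open>k\<close> with \<open>len64 q \<le> k < 2 * len64 q\<close>.\<close>

definition len64 :: "nat \<Rightarrow> nat" where "len64 q = floorlog 64 q"

lemma len64_bounds: "64 ^ (len64 q - 1) \<le> q \<and> q < 64 ^ len64 q" if "q \<ge> 1"
  using floorlog_bounds[of q 64] that by (simp add: len64_def)

lemma len64_ge_1: "len64 q \<ge> 1" if "q \<ge> 1"
  using that by (simp add: len64_def floorlog_def)

lemma len64_mono: "q \<le> r \<Longrightarrow> len64 q \<le> len64 r"
  unfolding len64_def by (rule floorlog_mono)

text \<open>Passing from \<open>r\<close> to \<open>64 * r\<close> adds exactly one base 64 digit,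
  and \<open>r\<close> already has at least one.\<close>

lemma len64_le_double: "len64 q \<le> 2 * len64 r" if "r \<ge> 1" "q \<le> 2 * r"
proof -
  have "len64 q \<le> len64 (r * 64)" using that by (intro len64_mono) auto
  also have "\<dots> = len64 r + 1"
    using that by (simp add: len64_def floorlog_def log_mult nat_add_distrib)
  finally show ?thesis using len64_ge_1[OF that(1)] by simp
qed

lemma log_le_len64: "log 2 (real q) \<le> 6 * real (len64 q)" if "q \<ge> 1"
proof -
  have "real q < 64 ^ len64 q" using len64_bounds[OF that] by (metis of_nat_less_iff of_nat_numeral of_nat_power)
  then have "log 2 (real q) \<le> log 2 (64 ^ len64 q)" using that by (subst log_le_cancel_iff) auto
  also have "\<dots> = real (len64 q) * log 2 (2 ^ 6)" by (subst log_nat_power) auto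
  also have "\<dots> = 6 * real (len64 q)" by (subst log_nat_power) auto
  finally show ?thesis .
qed

lemma filterlim_len64: "filterlim len64 at_top sequentially"
  unfolding filterlim_at_top
proof
  fix Z
  have "Z \<le> len64 q" if "q \<ge> 64 ^ Z" for q
  proof -
    have "q \<ge> 1" using that by (metis le_trans one_le_numeral one_le_power)
    with that have "(64::nat) ^ Z < 64 ^ len64 q" using len64_bounds[of q] by linarith
    then have "Z < len64 q" by simp
    then show ?thesis by simp
  qed
  then show "\<forall>\<^sub>F q in sequentially. Z \<le> len64 q" by (rule eventually_sequentiallyI)
qed

text \<open>Each multiple \<open>q\<close> of \<open>a\<close> is charged to a block of at least
  \<open>a / 2\<close> integers ending at \<open>q\<close>, on which the weight is at least
  \<open>w q / 2\<close>. The blocks are disjoint, whence the factor \<open>4 / a\<close>.\<close>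

lemma sum_multiples_le:
  fixes w :: "nat \<Rightarrow> real"
  assumes w: "\<And>q. w q \<ge> 0"
    and doubling: "\<And>q r. 1 \<le> r \<Longrightarrow> r \<le> q \<Longrightarrow> q \<le> 2 * r \<Longrightarrow> w q \<le> 2 * w r"
    and a: "a \<ge> 1"
  shows "(\<Sum>q | q \<in> {1..N} \<and> a dvd q. w q) \<le> 4 / real a * (\<Sum>q=1..N. w q)"
proof -
  let ?D = "{q. q \<in> {1..N} \<and> a dvd q}"
  \<comment> \<open>This length keeps the block shorter than the gap \<open>a\<close> between
    multiples and, as \<open>a \<le> q\<close>, keeps \<open>q \<le> 2 * r\<close> for every
    \<open>r\<close> in it, so that \<open>doubling\<close> applies.\<close>
  define I where "I q = {q - (a - 1) div 2..q}" for q
  have le: "real a / 4 * w q \<le> (\<Sum>r\<in>I q. w r)" if "q \<in> ?D" for q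
  proof -
    have aq: "a \<le> q" using that by (auto dest: dvd_imp_le)
    have "real a / 2 \<le> real (card (I q))" using aq a by (simp add: I_def)
    then have "real a / 2 * (w q / 2) \<le> real (card (I q)) * (w q / 2)"
      using w[of q] by (intro mult_right_mono) auto
    also have "\<dots> = (\<Sum>r\<in>I q. w q / 2)" by simp
    also have "\<dots> \<le> (\<Sum>r\<in>I q. w r)"
    proof (rule sum_mono)
      fix r assume "r \<in> I q"
      then have "1 \<le> r" "r \<le> q" "q \<le> 2 * r" using aq a unfolding I_def by auto
      from doubling[OF this] show "w q / 2 \<le> w r" by simp
    qed
    finally show ?thesis by simp
  qed
  have disj: "I q \<inter> I r = {}" if "q \<in> ?D" "r \<in> ?D" "q < r" for q r
  proof -
    have "a dvd r - q" using that by (auto intro: dvd_diff_nat)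
    then have "a \<le> r - q" using that by (intro dvd_imp_le) auto
    then show ?thesis using a by (auto simp: I_def)
  qed
  have "real a / 4 * (\<Sum>q\<in>?D. w q) \<le> (\<Sum>q\<in>?D. \<Sum>r\<in>I q. w r)"
    unfolding sum_distrib_left by (intro sum_mono le)
  also have "\<dots> = (\<Sum>r\<in>(\<Union>q\<in>?D. I q). w r)"
  proof (rule sum.UNION_disjoint [symmetric])
    show "\<forall>q\<in>?D. \<forall>r\<in>?D. q \<noteq> r \<longrightarrow> I q \<inter> I r = {}"
    proof (intro ballI impI)
      fix q r assume "q \<in> ?D" "r \<in> ?D" "q \<noteq> r"
      with disj[of q r] disj[of r q] show "I q \<inter> I r = {}"
        by (cases "q < r") (simp_all add: Int_commute)
    qed
  qed (auto simp: I_def)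
  also have "\<dots> \<le> (\<Sum>r=1..N. w r)"
  proof (rule sum_mono2)
    show "(\<Union>q\<in>?D. I q) \<subseteq> {1..N}" 
    proof
      fix r assume "r \<in> (\<Union>q\<in>?D. I q)"
      then obtain q where "q \<in> ?D" "r \<in> I q" by auto
      moreover from this have "a \<le> q" by (auto dest: dvd_imp_le)
      ultimately show "r \<in> {1..N}" using a by (auto simp: I_def)
    qed
  qed (auto simp: w)
  finally show ?thesis using a by (simp add: field_simps)
qed

text \<open>The weight itself need not be monotone; this is the substitute that
  \<open>sum_multiples_le\<close> asks for.\<close>

lemma weight_doubling:
  fixes \<psi> :: "nat \<Rightarrow> real"
  assumes pos: "\<And>q. q \<ge> 1 \<Longrightarrow> \<psi> q > 0" and anti: "antimono_on {1..} \<psi>"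
    and r: "1 \<le> r" "r \<le> q" "q \<le> 2 * r"
  shows "\<psi> q * real (len64 q) \<le> 2 * (\<psi> r * real (len64 r))"
proof -
  have "\<psi> q \<le> \<psi> r" using anti r by (auto simp: monotone_on_def)
  moreover have "real (len64 q) \<le> 2 * real (len64 r)" using len64_le_double[of r q] r by linarith
  ultimately have "\<psi> q * real (len64 q) \<le> \<psi> r * (2 * real (len64 r))"
    using pos[of r] r by (intro mult_mono) auto
  then show ?thesis by simp
qed

lemma antimono_on_min_inverse:
  fixes \<psi> :: "nat \<Rightarrow> real"
  assumes "antimono_on {1..} \<psi>"
  shows "antimono_on {1..} (\<lambda>q. min (\<psi> q) (1 / (64 * real q)))"
  using assms by (auto simp: monotone_on_def min_le_iff_disj frac_le)

text \<open>Truncating \<open>\<psi>\<close> at \<open>1 / (64 q)\<close> keeps the divergence: if the truncation is effective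
  at \<open>q\<close>, then by monotonicity the range up to \<open>q\<close> alone contributes a multiple of \<open>log q\<close>.\<close>

lemma filterlim_truncated_weights:
  fixes \<psi> :: "nat \<Rightarrow> real"
  assumes pos: "\<And>q. q \<ge> 1 \<Longrightarrow> \<psi> q > 0" and anti: "antimono_on {1..} \<psi>"
    and div: "filterlim (\<lambda>N. \<Sum>q=1..N. \<psi> q * log 2 (real q)) at_top sequentially"
  shows "filterlim (\<lambda>N. \<Sum>q=1..N. min (\<psi> q) (1 / (64 * real q)) * real (len64 q)) at_top sequentially"
proof -
  define p where "p q = min (\<psi> q) (1 / (64 * real q))" for q
  define w where "w q = (if q \<ge> 1 then p q * real (len64 q) else 0)" for q
  define W where "W N = (\<Sum>q=1..N. w q)" for N
  have p: "p q > 0" if "q \<ge> 1" for q using pos[of q] that by (simp add: p_def)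
  have w0: "w q \<ge> 0" for q by (auto simp: w_def intro!: mult_nonneg_nonneg less_imp_le[OF p])
  have "antimono_on {1..} p" unfolding p_def [abs_def] using anti by (rule antimono_on_min_inverse)
  with p have dbl: "w q \<le> 2 * w r" if "1 \<le> r" "r \<le> q" "q \<le> 2 * r" for q r
    using weight_doubling[of p r q] that by (simp add: w_def)
  have mono: "W M \<le> W N" if "M \<le> N" for M N
    unfolding W_def using that w0 by (intro sum_mono2) auto
  have "filterlim W at_top sequentially"
  proof (cases "\<exists>n0. \<forall>q\<ge>n0. \<psi> q \<le> 1 / (64 * real q)")
    case True
    then obtain n0 where n0: "\<And>q. q \<ge> n0 \<Longrightarrow> \<psi> q \<le> 1 / (64 * real q)" by auto
    define S where "S N = (\<Sum>q=1..N. \<psi> q * log 2 (real q))" for N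
    \<comment> \<open>Beyond \<open>n0\<close> the truncation is inactive, and
      \<open>log_le_len64\<close> compares the increments; \<open>S n0\<close> accounts for the
      initial range.\<close>
    have SW: "S N \<le> 6 * W N + S n0" if N: "N \<ge> n0" for N
      using N
    proof (induction N rule: dec_induct)
      case base
      then show ?case using w0 by (simp add: W_def sum_nonneg)
    next
      case (step N)
      have "\<psi> (Suc N) * log 2 (real (Suc N)) \<le> p (Suc N) * (6 * real (len64 (Suc N)))"
        using n0[of "Suc N"] step log_le_len64[of "Suc N"] pos[of "Suc N"]
        by (auto simp: p_def min_def intro!: mult_left_mono)
      then show ?case using step by (simp add: S_def W_def w_def)
    qed
    have ev: "\<forall>\<^sub>F N in sequentially. 1 / 6 * (- S n0 + S N) \<le> W N"
    proof (rule eventually_sequentiallyI)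
      fix N assume "n0 \<le> N"
      have "1 / 6 * (- c + x) \<le> y" if "x \<le> 6 * y + c" for x y c :: real using that by simp
      from this[OF SW[OF \<open>n0 \<le> N\<close>]] show "1 / 6 * (- S n0 + S N) \<le> W N" .
    qed
    have "filterlim S at_top sequentially" using div by (simp add: S_def [abs_def])
    then have "filterlim (\<lambda>N. 1 / 6 * (- S n0 + S N)) at_top sequentially"
      by (intro filterlim_tendsto_pos_mult_at_top[OF tendsto_const] filterlim_tendsto_add_at_top[OF tendsto_const]) auto
    then show ?thesis using ev by (rule filterlim_at_top_mono)
  next
    case False
    show ?thesis
      unfolding filterlim_at_top
    proof
      fix B :: real
      have "filterlim (\<lambda>q. real (len64 q)) at_top sequentially"
        by (rule filterlim_compose[OF filterlim_real_sequentially filterlim_len64])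
      then obtain n1 where n1: "\<And>q. q \<ge> n1 \<Longrightarrow> real (len64 q) \<ge> 256 * B"
        unfolding filterlim_at_top eventually_sequentially by metis
      obtain q where q: "q \<ge> max n1 1" "\<psi> q > 1 / (64 * real q)" using False by (meson not_le)
      \<comment> \<open>The only multiple of \<open>q\<close> up to \<open>q\<close> is
        \<open>q\<close> itself, so \<open>sum_multiples_le\<close> with \<open>a\<close> and
        \<open>N\<close> both equal to \<open>q\<close> gives
        \<open>real q * w q \<le> 4 * W q\<close>. As the cap is attained at \<open>q\<close>, the
        left side is \<open>len64 q / 64\<close>; hence the constant 256 = 4 * 64.\<close>
      have "w q = (\<Sum>r | r \<in> {q} . w r)" by simp
      also have "\<dots> \<le> (\<Sum>r | r \<in> {1..q} \<and> q dvd r. w r)"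
        using q w0 by (intro sum_mono2) auto
      also have "\<dots> \<le> 4 / real q * W q"
        unfolding W_def using q by (intro sum_multiples_le w0 dbl) auto
      finally have "real q * w q \<le> 4 * W q" using q by (simp add: field_simps)
      moreover have "real q * w q = real (len64 q) / 64"
        using q by (simp add: w_def p_def min_def)
      moreover have "256 * B \<le> real (len64 q)" using q by (intro n1) simp
      ultimately have "B \<le> W q" by simp
      with mono show "\<forall>\<^sub>F N in sequentially. B \<le> W N"
        by (intro eventually_sequentiallyI[of q]) (meson order_trans)
    qed
  qed
  then show ?thesis by (simp add: W_def [abs_def] w_def p_def)
qed

section \<open>Overlaps in two dimensions\<close>

text \<open>With the geometric means \<open>A\<close> and \<open>B\<close>, the product expands into
  the main term, two mixed terms and \<open>4 * u * v\<close>. Each of the last three carries a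
  factor \<open>A * B\<close>, which is the square root taken outside the bracket.\<close>

lemma overlap_product_le:
  fixes \<alpha> \<alpha>' \<beta> \<beta>' q r g :: real
  assumes pos: "\<alpha> > 0" "\<alpha>' > 0" "\<beta> > 0" "\<beta>' > 0" "q > 0" "r > 0" "g > 0"
  defines "G \<equiv> g / sqrt (q * r)" and "s \<equiv> sqrt ((\<alpha> / q) / (\<alpha>' / r))"
  shows "(4 * \<alpha> * \<alpha>' + 2 * g * min (\<alpha> / q) (\<alpha>' / r)) * (4 * \<beta> * \<beta>' + 2 * g * min (\<beta> / q) (\<beta>' / r))
    \<le> 16 * (\<alpha> * \<beta>) * (\<alpha>' * \<beta>') + sqrt (\<alpha> * \<beta> * (\<alpha>' * \<beta>'))
      * (8 * G * sqrt (\<alpha> * \<alpha>') + 8 * G * sqrt (\<beta> * \<beta>') + 4 * G\<^sup>2 * min s (1 / s))"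
proof -
  define A B where "A = sqrt (\<alpha> * \<alpha>')" and "B = sqrt (\<beta> * \<beta>')"
  define u v where "u = g * min (\<alpha> / q) (\<alpha>' / r)" and "v = g * min (\<beta> / q) (\<beta>' / r)"
  have A: "A > 0" "\<alpha> * \<alpha>' = A * A" and B: "B > 0" "\<beta> * \<beta>' = B * B"
    using pos by (auto simp: A_def B_def)
  have G: "G > 0" using pos by (simp add: G_def)
  have "g * sqrt ((\<alpha> / q) * (\<alpha>' / r)) = G * A" "g * sqrt ((\<beta> / q) * (\<beta>' / r)) = G * B"
    by (simp_all add: G_def A_def B_def real_sqrt_mult real_sqrt_divide)
  moreover have "u \<le> g * sqrt ((\<alpha> / q) * (\<alpha>' / r))" "v \<le> g * sqrt ((\<beta> / q) * (\<beta>' / r))"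
    unfolding u_def v_def using pos by (intro mult_left_mono min_le_sqrt_mult; simp)+
  moreover have "u = g * sqrt ((\<alpha> / q) * (\<alpha>' / r)) * min s (1 / s)"
    unfolding u_def s_def using pos by (subst min_eq_sqrt_mult) auto
  ultimately have uv: "u \<le> G * A" "v \<le> G * B" "u = G * A * min s (1 / s)" by simp_all
  have "u \<ge> 0" "v \<ge> 0" using pos by (simp_all add: u_def v_def)
  have "(4 * \<alpha> * \<alpha>' + 2 * g * min (\<alpha> / q) (\<alpha>' / r)) * (4 * \<beta> * \<beta>' + 2 * g * min (\<beta> / q) (\<beta>' / r))
      = (4 * (\<alpha> * \<alpha>') + 2 * u) * (4 * (\<beta> * \<beta>') + 2 * v)"
    by (simp add: u_def v_def mult_ac)
  also have "\<dots> = 16 * (A * A) * (B * B) + 8 * (A * A) * v + 8 * (B * B) * u + 4 * u * v"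
    unfolding A B by (simp add: algebra_simps)
  \<comment> \<open>In \<open>u * v\<close> only \<open>v\<close> is replaced by its geometric mean
    bound. The exact form of \<open>u\<close> keeps the decay in the ratio \<open>s\<close>, without
    which the sum over \<open>m * n\<close> pairs of scales would be of order \<open>m * n\<close>
    instead of \<open>sqrt (m * n)\<close>.\<close>
  also have "\<dots> \<le> 16 * (A * A) * (B * B) + 8 * (A * A) * (G * B) + 8 * (B * B) * (G * A)
      + 4 * u * (G * B)"
    using uv \<open>u \<ge> 0\<close> A B by (intro add_mono mult_left_mono) auto
  also have "4 * u * (G * B) = A * B * (4 * G\<^sup>2 * min s (1 / s))"
    by (subst uv(3)) (simp add: power2_eq_square mult_ac)
  also have "16 * (A * A) * (B * B) + 8 * (A * A) * (G * B) + 8 * (B * B) * (G * A)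
      + A * B * (4 * G\<^sup>2 * min s (1 / s))
    = 16 * (A * A) * (B * B) + A * B * (8 * G * A + 8 * G * B + 4 * G\<^sup>2 * min s (1 / s))"
    by (simp add: algebra_simps)
  also have "A * B = sqrt (\<alpha> * \<beta> * (\<alpha>' * \<beta>'))"
    unfolding A_def B_def by (simp add: mult_ac flip: real_sqrt_mult)
  also have "16 * (A * A) * (B * B) = 16 * (\<alpha> * \<beta>) * (\<alpha>' * \<beta>')"
    unfolding A(2)[symmetric] B(2)[symmetric] by simp
  finally show ?thesis by (simp add: A_def B_def)
qed

text \<open>As 64 is the sixth power of 2, taking sixth roots in \<open>q < 64 ^ len64 q\<close>
  suffices.\<close>

lemma half_power_len64_le: "(1/2) ^ len64 q \<le> real q powr (-1/6)" if "q \<ge> 1"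
proof -
  have "real q < 64 ^ len64 q" using len64_bounds[OF that] by (metis of_nat_less_iff of_nat_numeral of_nat_power)
  then have "real q powr (1/6) \<le> (64 ^ len64 q) powr (1/6)" by (intro powr_mono2) auto
  also have "(64::real) ^ len64 q = (2 ^ 6) ^ len64 q" by simp
  also have "\<dots> = (2 ^ len64 q) ^ 6" by (simp only: power_mult [symmetric] mult.commute)
  also have "\<dots> powr (1/6) = 2 ^ len64 q"
  proof -
    define t :: real where "t = 2 ^ len64 q"
    have "t > 0" by (simp add: t_def)
    then have "t ^ 6 = t powr 6" using powr_realpow[of t 6] by simp
    then have "(t ^ 6) powr (1/6) = t powr (6 * (1/6))" by (simp only: powr_powr)
    with \<open>t > 0\<close> have "(t ^ 6) powr (1/6) = t" by simp
    then show ?thesis by (simp add: t_def)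
  qed
  finally have "real q powr (1/6) \<le> 2 ^ len64 q" .
  then have "inverse (2 ^ len64 q) \<le> inverse (real q powr (1/6))"
    using that by (intro le_imp_inverse_le) auto
  then show ?thesis by (simp add: powr_minus power_one_over inverse_eq_divide)
qed

lemma sum_half_power_le: "(\<Sum>k=n..<2*n. (1/2::real) ^ k) \<le> 2 * (1/2) ^ n"
proof -
  have "(\<Sum>k=n..<m. (1/2::real) ^ k) = 2 * (1/2) ^ n - 2 * (1/2) ^ m" if "n \<le> m" for m
    using that by (induction m rule: dec_induct) auto
  from this[of "2 * n"] show ?thesis by simp
qed

lemma sum_two_power_le: "(\<Sum>k=n..<2*n. (2::real) ^ k) \<le> 4 ^ n"
proof -
  have "(\<Sum>k=n..<2*n. (2::real) ^ k) \<le> (\<Sum>k<2*n. (2::real) ^ k)"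
    by (rule sum_mono2) auto
  also have "\<dots> \<le> 2 ^ (2 * n)" by (simp add: geometric_sum)
  also have "\<dots> = 4 ^ n" by (simp add: power_mult)
  finally show ?thesis .
qed

text \<open>Here \<open>s k l\<close> is \<open>2 ^ l / 2 ^ k\<close> times a constant, so with
  either index fixed the other sum is at most 4. The total is thus at most \<open>4 * m\<close> and
  at most \<open>4 * n\<close>, hence at most 4 times their geometric mean.\<close>

lemma sum_sum_min_ratio_le:
  fixes q r :: real
  assumes q: "q > 0" and r: "r > 0"
  defines "s \<equiv> \<lambda>k l. sqrt (((1/4) ^ k / q) / ((1/4) ^ l / r))"
  shows "(\<Sum>k=m..<2*m. \<Sum>l=n..<2*n. min (s k l) (1 / s k l)) \<le> 4 * sqrt (real m * real n)"
proof -
  have geo: "(\<Sum>l=n..<2*n. min (2 ^ l * c) (1 / (2 ^ l * c))) \<le> 4" if "c > 0" for n and c :: real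
  proof -
    have "(\<Sum>l=n..<2*n. min (2 ^ l * c) (1 / (2 ^ l * c))) \<le> (\<Sum>l<2*n. min (2 ^ l * c) (1 / (2 ^ l * c)))"
      using that by (intro sum_mono2) auto
    also have "\<dots> \<le> 4" using that by (rule sum_min_geometric_le)
    finally show ?thesis .
  qed
  have s1: "s k l = 2 ^ l * ((1/2) ^ k * sqrt (r / q))" for k l
    by (simp add: s_def real_sqrt_mult real_sqrt_divide real_sqrt_power power_divide)
  have s2: "1 / s k l = 2 ^ k * ((1/2) ^ l * sqrt (q / r))" for k l
    by (simp add: s_def real_sqrt_mult real_sqrt_divide real_sqrt_power power_divide)
  let ?S = "\<Sum>k=m..<2*m. \<Sum>l=n..<2*n. min (s k l) (1 / s k l)"
  have "?S \<le> (\<Sum>k=m..<2*m. 4)"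
    unfolding s1 using q r by (intro sum_mono geo) auto
  then have 1: "?S \<le> 4 * real m" by simp
  have "?S = (\<Sum>l=n..<2*n. \<Sum>k=m..<2*m. min (1 / s k l) (1 / (1 / s k l)))"
    by (subst sum.swap) (simp add: min.commute)
  also have "\<dots> \<le> (\<Sum>l=n..<2*n. 4)"
    unfolding s2 using q r by (intro sum_mono geo) auto
  finally have 2: "?S \<le> 4 * real n" by simp
  have "?S \<le> 4 * min (real m) (real n)" using 1 2 by simp
  also have "\<dots> \<le> 4 * sqrt (real m * real n)" by (intro mult_left_mono min_le_sqrt_mult) auto
  finally show ?thesis .
qed

text \<open>The \<open>m * n\<close> main terms add up to the product of the expected measures. Of
  the error terms, the first is a decreasing geometric sum from the lower end of the scales, the
  second an increasing one controlled at the upper end by the bound on \<open>p\<close>, and the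
  third is \<open>sum_sum_min_ratio_le\<close>.\<close>

lemma pair_overlap_le:
  fixes p p' :: real and q r :: nat
  assumes q: "q \<ge> 1" and r: "r \<ge> 1"
    and p: "0 < p" "p * 64 ^ len64 q \<le> 1" and p': "0 < p'" "p' * 64 ^ len64 r \<le> 1"
  shows "(\<Sum>k=len64 q..<2 * len64 q. \<Sum>l=len64 r..<2 * len64 r.
      measure lborel (near_set q \<gamma> ((1/4) ^ k) \<inter> near_set r \<gamma> ((1/4) ^ l)) *
      measure lborel (near_set q \<gamma>' (p * 4 ^ k) \<inter> near_set r \<gamma>' (p' * 4 ^ l)))
    \<le> (4 * (p * real (len64 q))) * (4 * (p' * real (len64 r)))
      + 56 * (((real (gcd q r))\<^sup>2 / (real q * real r)) powr (2/3)
        * sqrt ((p * real (len64 q)) * (p' * real (len64 r))))"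
proof -
  define m n where "m = len64 q" and "n = len64 r"
  define g where "g = real (gcd q r)"
  define G where "G = g / sqrt (real q * real r)"
  define s where "s k l = sqrt (((1/4) ^ k / real q) / ((1/4) ^ l / real r))" for k l :: nat
  define x where "x = g\<^sup>2 / (real q * real r)"
  have m: "m \<ge> 1" and n: "n \<ge> 1" unfolding m_def n_def using q r by (blast intro: len64_ge_1)+
  have g: "g \<ge> 1" using q by (simp add: g_def Suc_le_eq)
  have small: "(1/4 :: real) ^ k < 1/2" if "k \<ge> 1" for k
    using power_decreasing[OF that, of "1/4::real"] by simp
  have small': "t * 4 ^ k < 1/2" if t: "0 < t" "t * 64 ^ j \<le> 1" and "k < 2 * j" for t :: real and j k
  proof -
    have "t * 4 ^ k \<le> t * 4 ^ (2 * j)" using that by (intro mult_left_mono power_increasing) auto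
    \<comment> \<open>The upper end \<open>2 * j\<close> of the scales gives 16 to the power
      \<open>j\<close>, a factor \<open>4 ^ j\<close> below the \<open>64 ^ j\<close> that the
      hypothesis on \<open>t\<close> allows.\<close>
    also have "\<dots> = t * 64 ^ j * (1/4) ^ j"
      by (simp add: power_mult mult.assoc flip: power_mult_distrib)
    also have "\<dots> \<le> 1 * (1/4) ^ j" using t by (intro mult_right_mono) auto
    also have "\<dots> < 1/2" using small[of j] that by simp
    finally show ?thesis .
  qed
  have summand: "measure lborel (near_set q \<gamma> ((1/4) ^ k) \<inter> near_set r \<gamma> ((1/4) ^ l)) *
      measure lborel (near_set q \<gamma>' (p * 4 ^ k) \<inter> near_set r \<gamma>' (p' * 4 ^ l))
    \<le> 16 * p * p' + sqrt (p * p') * (8 * G * ((1/2) ^ k * (1/2) ^ l)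
        + 8 * G * ((sqrt p * 2 ^ k) * (sqrt p' * 2 ^ l)) + 4 * x * min (s k l) (1 / s k l))"
    if k: "k \<in> {m..<2*m}" and l: "l \<in> {n..<2*n}" for k l
  proof -
    have "measure lborel (near_set q \<gamma> ((1/4) ^ k) \<inter> near_set r \<gamma> ((1/4) ^ l)) *
        measure lborel (near_set q \<gamma>' (p * 4 ^ k) \<inter> near_set r \<gamma>' (p' * 4 ^ l))
      \<le> (4 * (1/4) ^ k * (1/4) ^ l + 2 * g * min ((1/4) ^ k / q) ((1/4) ^ l / r))
       * (4 * (p * 4 ^ k) * (p' * 4 ^ l) + 2 * g * min (p * 4 ^ k / q) (p' * 4 ^ l / r))"
      unfolding g_def using k l m n q r p p' small[of k] small[of l]
        small'[of p m k] small'[of p' n l]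
      by (intro mult_mono measure_near_set_Int_le) (auto simp: m_def n_def)
    also have "\<dots> \<le> 16 * ((1/4) ^ k * (p * 4 ^ k)) * ((1/4) ^ l * (p' * 4 ^ l))
      + sqrt ((1/4) ^ k * (p * 4 ^ k) * ((1/4) ^ l * (p' * 4 ^ l)))
      * (8 * G * sqrt ((1/4) ^ k * (1/4) ^ l) + 8 * G * sqrt (p * 4 ^ k * (p' * 4 ^ l))
         + 4 * G\<^sup>2 * min (s k l) (1 / s k l))"
      unfolding G_def s_def using p p' q r g by (intro overlap_product_le) auto
    also have "(1/4) ^ k * (p * 4 ^ k) = p" by (simp add: power_divide)
    also have "(1/4) ^ l * (p' * 4 ^ l) = p'" by (simp add: power_divide)
    also have "sqrt ((1/4) ^ k * (1/4) ^ l) = (1/2) ^ k * (1/2) ^ l"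
      by (simp add: real_sqrt_mult real_sqrt_power real_sqrt_divide)
    also have "sqrt (p * 4 ^ k * (p' * 4 ^ l)) = (sqrt p * 2 ^ k) * (sqrt p' * 2 ^ l)"
      by (simp add: real_sqrt_mult real_sqrt_power)
    also have "G\<^sup>2 = x" by (simp add: G_def x_def power_divide)
    finally show ?thesis .
  qed
  define D where "D = (1/2::real) ^ m * (1/2) ^ n"
  have sum1: "(\<Sum>k=m..<2*m. \<Sum>l=n..<2*n. (1/2::real) ^ k * (1/2) ^ l) \<le> 4 * D"
  proof -
    have "(\<Sum>k=m..<2*m. (1/2::real) ^ k) * (\<Sum>l=n..<2*n. (1/2) ^ l) \<le> (2 * (1/2) ^ m) * (2 * (1/2) ^ n)"
      by (intro mult_mono sum_half_power_le sum_nonneg) auto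
    then show ?thesis by (simp add: sum_product D_def)
  qed
  \<comment> \<open>\<open>sqrt t\<close> is at most \<open>(1/8) ^ j\<close> and the powers of 2
    sum to at most \<open>4 ^ j\<close>, leaving \<open>(1/2) ^ j\<close>, the same saving as at the
    lower end.\<close>
  have sqrt_sum: "(\<Sum>k=j..<2*j. sqrt t * 2 ^ k) \<le> (1/2) ^ j" if t: "0 < t" "t * 64 ^ j \<le> 1" for t j
  proof -
    have "t \<le> (1/64) ^ j" using t by (simp add: power_divide field_simps)
    also have "(1/64::real) ^ j = ((1/8) ^ j)\<^sup>2" by (simp add: power2_eq_square flip: power_mult_distrib)
    finally have "sqrt t \<le> (1/8) ^ j" by (intro real_le_lsqrt) auto
    then have "sqrt t * (\<Sum>k=j..<2*j. 2 ^ k) \<le> (1/8) ^ j * 4 ^ j"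
      using t by (intro mult_mono sum_two_power_le sum_nonneg) auto
    also have "\<dots> = (1/2) ^ j" by (simp flip: power_mult_distrib)
    finally show ?thesis by (simp add: sum_distrib_left)
  qed
  have sum2: "(\<Sum>k=m..<2*m. \<Sum>l=n..<2*n. (sqrt p * 2 ^ k) * (sqrt p' * 2 ^ l)) \<le> D"
  proof -
    have "(\<Sum>k=m..<2*m. sqrt p * 2 ^ k) * (\<Sum>l=n..<2*n. sqrt p' * 2 ^ l) \<le> D"
      unfolding D_def using p p' by (intro mult_mono sqrt_sum sum_nonneg) (auto simp: m_def n_def)
    then show ?thesis by (simp add: sum_product)
  qed
  have sum3: "(\<Sum>k=m..<2*m. \<Sum>l=n..<2*n. min (s k l) (1 / s k l)) \<le> 4 * sqrt (real m * real n)"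
    unfolding s_def using q r by (intro sum_sum_min_ratio_le) auto
  have x0: "x > 0" using g q r by (simp add: x_def)
  have x1: "x \<le> 1"
  proof -
    have "gcd q r \<le> q" "gcd q r \<le> r" using q r by (auto intro: dvd_imp_le)
    then have "g * g \<le> real q * real r" unfolding g_def by (intro mult_mono) auto
    then show ?thesis using q r by (simp add: x_def power2_eq_square)
  qed
  have G: "G = x powr (1/2)"
    using g by (simp add: G_def x_def powr_half_sqrt real_sqrt_divide)
  \<comment> \<open>The exponent 2/3 arises as 1/2 + 1/6: \<open>G\<close> is the square root of
    \<open>x\<close>, and \<open>D\<close> is at most \<open>x powr (1/6)\<close> because
    \<open>g \<ge> 1\<close>.\<close>
  have GD: "G * D \<le> x powr (2/3)"
  proof -
    have "D \<le> real q powr (-1/6) * real r powr (-1/6)"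
      unfolding D_def m_def n_def by (intro mult_mono half_power_len64_le q r) auto
    also have "\<dots> = inverse ((real q * real r) powr (1/6))"
      by (simp add: powr_minus powr_mult)
    also have "\<dots> = inverse (real q * real r) powr (1/6)" by (rule inverse_powr [symmetric])
    also have "\<dots> \<le> x powr (1/6)"
    proof (rule powr_mono2)
      have "1 \<le> g\<^sup>2" using g by simp
      then show "inverse (real q * real r) \<le> x"
        unfolding x_def divide_inverse using mult_right_mono[of 1 "g\<^sup>2" "inverse (real q * real r)"] by simp
    qed auto
    finally have "G * D \<le> x powr (1/2) * x powr (1/6)" unfolding G by (intro mult_left_mono) auto
    then show ?thesis by (simp flip: powr_add)
  qed
  have xx: "x \<le> x powr (2/3)"
    using powr_mono'[of "2/3" 1 x] x0 x1 by simp
  have mn: "1 \<le> sqrt (real m * real n)"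
    using mult_mono[of 1 "real m" 1 "real n"] m n by simp
  define U where "U = x powr (2/3) * sqrt (real m * real n)"
  have "G * D \<le> U" unfolding U_def using GD mn mult_mono[of "G * D" "x powr (2/3)" 1 "sqrt (real m * real n)"] by simp
  have xU: "x * sqrt (real m * real n) \<le> U" unfolding U_def using xx by (intro mult_right_mono) auto
  have G0: "G \<ge> 0" by (simp add: G)
  let ?T = "\<Sum>k=m..<2*m. \<Sum>l=n..<2*n.
      measure lborel (near_set q \<gamma> ((1/4) ^ k) \<inter> near_set r \<gamma> ((1/4) ^ l)) *
      measure lborel (near_set q \<gamma>' (p * 4 ^ k) \<inter> near_set r \<gamma>' (p' * 4 ^ l))"
  have "?T \<le> (\<Sum>k=m..<2*m. \<Sum>l=n..<2*n. 16 * p * p' + sqrt (p * p') * (8 * G * ((1/2) ^ k * (1/2) ^ l)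
        + 8 * G * ((sqrt p * 2 ^ k) * (sqrt p' * 2 ^ l)) + 4 * x * min (s k l) (1 / s k l)))"
    by (intro sum_mono summand)
  also have "\<dots> = 16 * p * p' * (real m * real n)
      + sqrt (p * p') * (8 * G * (\<Sum>k=m..<2*m. \<Sum>l=n..<2*n. (1/2) ^ k * (1/2) ^ l)
        + 8 * G * (\<Sum>k=m..<2*m. \<Sum>l=n..<2*n. (sqrt p * 2 ^ k) * (sqrt p' * 2 ^ l))
        + 4 * x * (\<Sum>k=m..<2*m. \<Sum>l=n..<2*n. min (s k l) (1 / s k l)))"
    unfolding sum.distrib sum_distrib_left [symmetric] by simp
  also have "\<dots> \<le> 16 * p * p' * (real m * real n)
      + sqrt (p * p') * (8 * G * (4 * D) + 8 * G * D + 4 * x * (4 * sqrt (real m * real n)))"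
    using G0 p p' x0 by (intro add_mono mult_left_mono sum1 sum2 sum3) auto
  also have "\<dots> = 16 * p * p' * (real m * real n)
      + sqrt (p * p') * (40 * (G * D) + 16 * (x * sqrt (real m * real n)))"
    by (simp add: algebra_simps)
  \<comment> \<open>All errors are absorbed into \<open>U\<close>, the terms with
    \<open>G * D\<close> because \<open>sqrt (m * n) \<ge> 1\<close>. The 40 is 8 * 4 + 8 and the 16
    is 4 * 4, in total 56.\<close>
  also have "\<dots> \<le> 16 * p * p' * (real m * real n) + sqrt (p * p') * (40 * U + 16 * U)"
    using \<open>G * D \<le> U\<close> xU p p' by (intro add_mono mult_left_mono) auto
  also have "sqrt (p * p') * (40 * U + 16 * U) = 56 * (x powr (2/3) * sqrt ((p * real m) * (p' * real n)))"
    by (simp add: U_def real_sqrt_mult)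
  finally show ?thesis by (simp add: m_def n_def x_def g_def mult_ac)
qed

section \<open>Assembling the variance bound and passing to Lebesgue measure\<close>

theorem corollary1p2:
  fixes \<psi> :: "nat \<Rightarrow> real" and \<gamma> \<gamma>' :: real
  assumes "\<And>q. q \<ge> 1 \<Longrightarrow> \<psi> q > 0"
    and "antimono_on {1..} \<psi>"
    and "filterlim (\<lambda>N. \<Sum>q=1..N. \<psi> q * log 2 (real q)) at_top sequentially"
    and "\<not> liouville \<gamma>"
  shows "AE (x, y) in lebesgue_on ({0..1} \<times> {0..1}).
    infinite {q::nat. q \<ge> 1 \<and>
      dist_int (real q * x - \<gamma>) * dist_int (real q * y - \<gamma>') \<le> \<psi> q}"
proof -
  \<comment> \<open>Since \<open>64 ^ len64 q \<le> 64 * q\<close>, this cap yields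
    \<open>p_le\<close>, which keeps all thresholds \<open>p q * 4 ^ k\<close> below 1/2.\<close>
  define p where "p q = min (\<psi> q) (1 / (64 * real q))" for q
  define w where "w q = p q * real (len64 q)" for q
  define K where "K q = {len64 q..<2 * len64 q}" for q
  define F where "F N = (SIGMA q:{1..N}. K q)" for N
  define A where "A i = near_set (fst i) \<gamma> ((1/4) ^ snd i)" for i
  define B where "B i = near_set (fst i) \<gamma>' (p (fst i) * 4 ^ snd i)" for i
  define E where "E i = A i \<times> B i" for i
  define M where "M = restrict_space (lborel :: (real \<times> real) measure) ({0..1} \<times> {0..1})"
  have sq: "{0..1} \<times> {0..1} \<in> sets (borel :: (real \<times> real) measure)"
    by (intro borel_closed closed_Times) auto
  have pos: "p q > 0" if "q \<ge> 1" for q using assms(1)[OF that] that by (simp add: p_def)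
  have p_anti: "antimono_on {1..} p"
    unfolding p_def [abs_def] by (rule antimono_on_min_inverse) (rule assms(2))
  have p_le: "p q * 64 ^ len64 q \<le> 1" if q: "q \<ge> 1" for q
  proof -
    have "64 ^ len64 q = 64 * (64::nat) ^ (len64 q - 1)"
      using len64_ge_1[OF q] by (simp flip: power_Suc)
    also have "\<dots> \<le> 64 * q" using len64_bounds[OF q] by simp
    finally have "real (64 ^ len64 q) \<le> real (64 * q)" by (rule of_nat_mono)
    then have "p q * 64 ^ len64 q \<le> 1 / (64 * real q) * (64 * real q)"
      by (intro mult_mono) (auto simp: p_def)
    then show ?thesis using q by simp
  qed
  \<comment> \<open>At \<open>q = 0\<close> the weight vanishes because \<open>floorlog\<close>
    takes the value 0 there.\<close>
  have w0: "w q \<ge> 0" for q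
    using pos[of q] by (cases "q = 0") (auto simp: w_def len64_def floorlog_def intro!: mult_nonneg_nonneg less_imp_le)
  have W: "filterlim (\<lambda>N. \<Sum>q=1..N. w q) at_top sequentially"
    unfolding w_def p_def using assms(1,2,3) by (rule filterlim_truncated_weights)
  have AB: "A i \<in> sets borel" "B i \<in> sets borel" for i by (auto simp: A_def B_def)
  have E_sets: "E i \<in> sets M" for i
    unfolding M_def E_def using AB[of i] sq
    by (subst sets_restrict_space_iff)
       (auto simp: A_def B_def near_set_def[where q = "fst i"] borel_prod[symmetric] intro!: pair_measureI)
  have finA: "emeasure lborel (near_set q c \<alpha> \<inter> S) < \<infinity>" for q c \<alpha> and S
  proof -
    have "emeasure lborel (near_set q c \<alpha> \<inter> S) \<le> emeasure lborel {0..1::real}"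
      by (intro emeasure_mono) (auto simp: near_set_def)
    then show ?thesis by (simp add: le_less_trans)
  qed
  have mE: "measure M (E i \<inter> E j) = measure lborel (A i \<inter> A j) * measure lborel (B i \<inter> B j)" for i j
  proof -
    have "measure M (E i \<inter> E j) = measure lborel (E i \<inter> E j)"
      unfolding M_def using sq
      by (intro measure_restrict_space) (auto simp: E_def A_def B_def near_set_def)
    also have "\<dots> = measure (lborel \<Otimes>\<^sub>M lborel) ((A i \<inter> A j) \<times> (B i \<inter> B j))"
      by (simp add: E_def Times_Int_Times lborel_prod)
    also have "\<dots> = measure lborel (A i \<inter> A j) * measure lborel (B i \<inter> B j)"
      using AB[of i] AB[of j] unfolding measure_def
      by (subst lborel.emeasure_pair_measure_Times) (auto simp: enn2real_mult)
    finally show ?thesis .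
  qed
  \<comment> \<open>The powers of 4 cancel, so all scales contribute equally and those for one
    \<open>q\<close> contribute \<open>4 * w q\<close> together.\<close>
  have mEi: "measure M (E (q, k)) = 4 * p q" if "q \<ge> 1" "k \<in> K q" for q k
  proof -
    have k: "len64 q \<le> k" "k < 2 * len64 q" using that by (auto simp: K_def)
    have 1: "(1/4 :: real) ^ j \<le> 1/4" if "j \<ge> 1" for j
      using power_decreasing[OF that, of "1/4::real"] by simp
    have "p q * 4 ^ k \<le> p q * 4 ^ (2 * len64 q)"
      using k pos[of q] that by (intro mult_left_mono power_increasing) auto
    also have "\<dots> = p q * 64 ^ len64 q * (1/4) ^ len64 q"
      by (simp add: power_mult mult.assoc flip: power_mult_distrib)
    also have "\<dots> \<le> 1 * (1/4)"
      using p_le[of q] pos[of q] that 1[of "len64 q"] len64_ge_1[of q] by (intro mult_mono) auto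
    finally have b: "p q * 4 ^ k < 1/2" by simp
    have "len64 q \<ge> 1" using that by (intro len64_ge_1)
    then have a: "(1/4 :: real) ^ k < 1/2" using 1[of k] k by simp
    have "measure M (E (q, k)) = measure lborel (A (q, k)) * measure lborel (B (q, k))"
      using mE[of "(q, k)" "(q, k)"] by simp
    also have "\<dots> = (2 * (1/4) ^ k) * (2 * (p q * 4 ^ k))"
      unfolding A_def B_def fst_conv snd_conv using that a b pos[of q]
      by (subst (1 2) measure_near_set) auto
    also have "\<dots> = 4 * p q" by (simp add: power_divide)
    finally show ?thesis .
  qed
  have finF: "finite (F N)" for N by (auto simp: F_def K_def)
  have S: "(\<Sum>i\<in>F N. measure M (E i)) = 4 * (\<Sum>q=1..N. w q)" for N
  proof -
    have "(\<Sum>i\<in>F N. measure M (E i)) = (\<Sum>q=1..N. \<Sum>k\<in>K q. measure M (E (q, k)))"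
      unfolding F_def by (subst sum.Sigma) (auto simp: K_def)
    also have "\<dots> = (\<Sum>q=1..N. \<Sum>k\<in>K q. 4 * p q)"
      by (intro sum.cong refl mEi) auto
    also have "\<dots> = 4 * (\<Sum>q=1..N. w q)" by (simp add: sum_distrib_left w_def K_def mult_ac)
    finally show ?thesis .
  qed
  define Z where "Z = (\<Sum>n. real n powr (-7/6))"
  have var: "(\<Sum>i\<in>F N. \<Sum>j\<in>F N. measure M (E i \<inter> E j))
      \<le> (\<Sum>i\<in>F N. measure M (E i))\<^sup>2 + 56 * Z\<^sup>2 * (\<Sum>i\<in>F N. measure M (E i))" for N
  proof -
    have "(\<Sum>i\<in>F N. \<Sum>j\<in>F N. measure M (E i \<inter> E j))
        = (\<Sum>q=1..N. \<Sum>k\<in>K q. \<Sum>r=1..N. \<Sum>l\<in>K r. measure M (E (q, k) \<inter> E (r, l)))"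
      unfolding F_def by (subst (1 2) sum.Sigma) (auto simp: K_def)
    also have "\<dots> = (\<Sum>q=1..N. \<Sum>r=1..N. \<Sum>k\<in>K q. \<Sum>l\<in>K r. measure M (E (q, k) \<inter> E (r, l)))"
      by (intro sum.cong refl sum.swap)
    also have "\<dots> \<le> (\<Sum>q=1..N. \<Sum>r=1..N. (4 * w q) * (4 * w r)
       + 56 * (((real (gcd q r))\<^sup>2 / (real q * real r)) powr (2/3) * sqrt (w q * w r)))"
      unfolding mE A_def B_def w_def fst_conv snd_conv K_def
      by (intro sum_mono pair_overlap_le pos p_le) auto
    also have "\<dots> = (4 * (\<Sum>q=1..N. w q))\<^sup>2 + 56 * (\<Sum>q=1..N. \<Sum>r=1..N.
        ((real (gcd q r))\<^sup>2 / (real q * real r)) powr (2/3) * sqrt (w q * w r))"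
      unfolding sum.distrib power2_eq_square sum_distrib_left [symmetric] sum_distrib_right [symmetric]
      by simp
    \<comment> \<open>The 4 comes from \<open>sum_multiples_le\<close>; it turns the sum of
      \<open>w\<close> into the mean \<open>4 * (\<Sum>q=1..N. w q)\<close>, so the variance
      constant is \<open>56 * Z\<^sup>2\<close>.\<close>
    also have "(\<Sum>q=1..N. \<Sum>r=1..N.
        ((real (gcd q r))\<^sup>2 / (real q * real r)) powr (2/3) * sqrt (w q * w r))
      \<le> 4 * Z\<^sup>2 * (\<Sum>q=1..N. w q)"
      unfolding Z_def
    proof (rule sum_gcd_weights_le)
      fix a assume "a \<in> {1..N}"
      then show "(\<Sum>q | q \<in> {1..N} \<and> a dvd q. w q) \<le> 4 / real a * (\<Sum>q=1..N. w q)"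
        using weight_doubling[OF pos p_anti] w0
        by (intro sum_multiples_le) (auto simp: w_def)
    qed (auto simp: w0)
    finally show ?thesis unfolding S by simp
  qed
  have "AE z in M. infinite {i \<in> (\<Union>N. F N). z \<in> E i}"
  proof (rule AE_infinite_of_variance_bound[OF _ _ finF E_sets _ var])
    have "emeasure M (space M) = 1"
      unfolding M_def using sq
      by (subst emeasure_restrict_space)
         (auto simp: space_restrict_space lborel_prod[symmetric] lborel.emeasure_pair_measure_Times)
    then show "finite_measure M" "measure M (space M) = 1"
      by (auto intro!: finite_measureI simp: measure_def)
    show "filterlim (\<lambda>N. \<Sum>i\<in>F N. measure M (E i)) at_top sequentially"
      unfolding S by (rule filterlim_tendsto_pos_mult_at_top[OF tendsto_const _ W]) simp
  qed
  then have "AE z in lborel. z \<in> {0..1} \<times> {0..1} \<longrightarrow> infinite {i \<in> (\<Union>N. F N). z \<in> E i}"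
    unfolding M_def using sq by (subst (asm) AE_restrict_space_iff) auto
  \<comment> \<open>Borel null sets stay null in the completion.\<close>
  then have "AE z in lebesgue. z \<in> {0..1} \<times> {0..1} \<longrightarrow> infinite {i \<in> (\<Union>N. F N). z \<in> E i}"
    by (rule AE_completion)
  then have "AE z in lebesgue_on ({0..1} \<times> {0..1}). infinite {i \<in> (\<Union>N. F N). z \<in> E i}"
    using sq by (subst AE_restrict_space_iff) (auto simp: sets_completionI_sets)
  then show ?thesis
  proof (rule AE_mp[OF _ AE_I2], clarify)
    fix x y
    assume inf: "infinite {i \<in> (\<Union>N. F N). (x, y) \<in> E i}"
      and fin: "finite {q::nat. q \<ge> 1 \<and> dist_int (real q * x - \<gamma>) * dist_int (real q * y - \<gamma>') \<le> \<psi> q}"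
        (is "finite ?Q")
    \<comment> \<open>Each \<open>q\<close> has only finitely many scales, so infinitely many pairs
      \<open>(q, k)\<close> force infinitely many \<open>q\<close>.\<close>
    have "{i \<in> (\<Union>N. F N). (x, y) \<in> E i} \<subseteq> (SIGMA q:?Q. K q)"
    proof
      fix i assume "i \<in> {i \<in> (\<Union>N. F N). (x, y) \<in> E i}"
      then obtain q k N where i: "i = (q, k)" "(q, k) \<in> F N" "(x, y) \<in> E (q, k)"
        by (cases i) auto
      then have q: "q \<ge> 1" and k: "k \<in> K q" by (auto simp: F_def)
      have "dist_int (real q * x - \<gamma>) * dist_int (real q * y - \<gamma>') \<le> (1/4) ^ k * (p q * 4 ^ k)"
        using i by (intro mult_mono) (auto simp: E_def A_def B_def near_set_def dist_int_def)
      also have "\<dots> = p q" by (simp add: power_divide)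
      also have "\<dots> \<le> \<psi> q" by (simp add: p_def)
      finally show "i \<in> (SIGMA q:?Q. K q)" using i(1) q k by simp
    qed
    moreover have "finite (SIGMA q:?Q. K q)" using fin by (auto simp: K_def)
    ultimately show False using inf finite_subset by blast
  qed
qed

end
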